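(* Let $D\ge 3$, let $\sigma$ be the $D$-dimensional spatial manifold, let $\gamma\subset\sigma$ be a piecewise analytic graph, let $v$ be a vertex of $\gamma$, and let $E(v)$ be the set of edges of $\gamma$ at $v$, all taken to be outgoing at $v$. Let $f:\mathrm{SO}(D+1)^{E(\gamma)}\to\mathbb{C}$ be twice differentiable. The building blocks $$R^{e}_{[IJ}R^{e'}_{KL]}f=0\qquad\text{for all } e,e'\in E(v)\ \text{and all } I,J,K,L$$ are a both necessary and sufficient set of conditions for all quantum simplicity constraints at $v$; that is, they hold if and only if for all surfaces $S,S'\subset\sigma$ through $v$ and all multi-indices $\overline{M}=(M_1,\dots,M_{D-3})$, $$\sum_{e,e'\in E(v)}\epsilon(e,S)\,\epsilon(e',S')\,\epsilon^{IJKL\overline{M}}\,R^{e}_{IJ}R^{e'}_{KL}f=0,$$ where repeated indices $I,J,K,L$ are summed over.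
   Context: A piecewise analytic graph $\gamma\subset\sigma$ consists of finitely many analytic edges (set $E(\gamma)$) which meet at most at their endpoints; the vertices are the endpoints of the edges. An edge $e:[0,1]\to\sigma$ is outgoing at $v$ if its beginning point $e(0)$ is $v$. An edge in $E(v)$ may be an analytic continuation through $v$ of another edge in $E(v)$. The function $f$ represents a cylindrical function of SO$(D+1)$ connections, its arguments being the holonomies along the edges of $\gamma$. A surface through $v$ is an oriented $(D-1)$-dimensional face $S:(-1/2,1/2)^{D-1}\to\sigma$ with $S(0,\dots,0)=v$, given by semianalytic (roughly: piecewise analytic) but at least once differentiable functions; its orientation specifies which side near $v$ is "above" and which is "below". For such $S$ and $e\in E(v)$, the type indicator $\epsilon(e,S)$ is $+1$ if the beginning segment of $e$ lies above $S$, $-1$ if it lies below $S$, and $0$ otherwise; it depends only on $S$ and $e$ near $v$. Indices $I,J,K,L,M_i$ run over $D+1$ values; $\epsilon^{IJKL\overline{M}}=\epsilon^{IJKLM_1\cdots M_{D-3}}$ is the totally antisymmetric symbol in $D+1$ indices, and square brackets around indices denote total antisymmetrisation. The basis of $\mathrm{so}(D+1)$ is $(\tau_{IJ})^K{}_L=\tfrac12(\delta^K_I\delta_{JL}-\delta^K_J\delta_{IL})$. For $e\in E(\gamma)$, $R^e_{IJ}$ is the right-invariant vector field acting on the factor of $\mathrm{SO}(D+1)^{E(\gamma)}$ labelled by $e$, i.e. on a function $F$ of a single group element, $(R_{IJ}F)(h)=\frac{d}{dt}\big|_{t=0}F(\exp(t\tau_{IJ})\,h)$. *)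

theory Defs
  imports "HOL-Analysis.Analysis"
begin

subsection \<open>Real-analytic and semianalytic maps\<close>

text \<open>Multi-indices are the extensional functions from the basis to the naturals;
  the power series is summed unconditionally.\<close>

definition real_analytic_at :: "('a::euclidean_space \<Rightarrow> 'b::real_normed_vector) \<Rightarrow> 'a \<Rightarrow> bool" where
  "real_analytic_at f x \<longleftrightarrow>
     (\<exists>r>0. \<exists>c. \<forall>y\<in>ball x r.
        ((\<lambda>\<alpha>. (\<Prod>b\<in>Basis. ((y - x) \<bullet> b) ^ \<alpha> b) *\<^sub>R c \<alpha>) has_sum f y) (Basis \<rightarrow>\<^sub>E (UNIV :: nat set)))"

definition real_analytic_on :: "('a::euclidean_space \<Rightarrow> 'b::real_normed_vector) \<Rightarrow> 'a set \<Rightarrow> bool" where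
  "real_analytic_on f U \<longleftrightarrow> (\<forall>x\<in>U. real_analytic_at f x)"

text \<open>Finitely many analytic functions \<open>H\<close> on a neighbourhood \<open>W\<close> of \<open>x\<close> partition \<open>W\<close>
  according to their signs (positive, zero, negative); on each part \<open>f\<close> has to agree with a
  function that is analytic on all of \<open>W\<close>.\<close>

definition semianalytic_at :: "('a::euclidean_space \<Rightarrow> 'b::real_normed_vector) \<Rightarrow> 'a \<Rightarrow> bool" where
  "semianalytic_at f x \<longleftrightarrow>
     (\<exists>W H. open W \<and> x \<in> W \<and> finite H \<and> (\<forall>h\<in>H. real_analytic_on h W) \<and>
        (\<forall>s :: ('a \<Rightarrow> real) \<Rightarrow> real. \<exists>g. real_analytic_on g W \<and>
            (\<forall>y\<in>W. (\<forall>h\<in>H. sgn (h y) = s h) \<longrightarrow> f y = g y)))"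

definition C1_immersion_at :: "('a::real_normed_vector \<Rightarrow> 'b::real_normed_vector) \<Rightarrow> 'a \<Rightarrow> bool" where
  "C1_immersion_at f x \<longleftrightarrow>
     (\<exists>W f'. open W \<and> x \<in> W \<and> (\<forall>y\<in>W. (f has_derivative blinfun_apply (f' y)) (at y)) \<and>
        continuous_on W f' \<and> inj (blinfun_apply (f' x)))"


subsection \<open>The spatial manifold\<close>

text \<open>The manifold is the whole type; a chart is a pair of its domain and its coordinate map.
  Values of coordinate maps outside the domain are irrelevant.\<close>

type_synonym ('a, 'd) chart = "'a set \<times> ('a \<Rightarrow> real ^ 'd)"

definition analytic_atlas ::
    "('a::{t2_space,second_countable_topology}, 'd::finite) chart set \<Rightarrow> bool" where
  "analytic_atlas \<A> \<longleftrightarrow>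
     (\<Union>(U, \<phi>)\<in>\<A>. U) = UNIV \<and>
     (\<forall>(U, \<phi>)\<in>\<A>. open U \<and> open (\<phi> ` U) \<and> homeomorphism U (\<phi> ` U) \<phi> (inv_into U \<phi>)) \<and>
     (\<forall>(U, \<phi>)\<in>\<A>. \<forall>(V, \<psi>)\<in>\<A>. real_analytic_on (\<psi> \<circ> inv_into U \<phi>) (\<phi> ` (U \<inter> V)))"


subsection \<open>Graphs\<close>

text \<open>An analytic edge is a regular analytic curve on \<open>[0,1]\<close> (analytic up to and including the
  endpoints) without self-intersections, except that \<open>simple_path\<close> allows the two endpoints to
  coincide.  As transition maps are analytic, it does not matter whether all charts or just
  some chart around \<open>e t\<close> is considered.\<close>

definition analytic_edge ::
    "('a::{t2_space,second_countable_topology}, 'd::finite) chart set \<Rightarrow> (real \<Rightarrow> 'a) \<Rightarrow> bool" where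
  "analytic_edge \<A> e \<longleftrightarrow>
     simple_path e \<and>
     (\<forall>t\<in>{0..1}. \<forall>(U, \<phi>)\<in>\<A>. e t \<in> U \<longrightarrow>
        (\<exists>g. real_analytic_at g t \<and> vector_derivative g (at t) \<noteq> 0 \<and>
             (\<forall>\<^sub>F s in nhds t. s \<in> {0..1} \<longrightarrow> \<phi> (e s) = g s)))"

text \<open>A graph is a family of edges labelled by a finite type.  The last condition forces
  different labels to carry different curves.\<close>

definition analytic_graph ::
    "('a::{t2_space,second_countable_topology}, 'd::finite) chart set \<Rightarrow> ('e::finite \<Rightarrow> real \<Rightarrow> 'a) \<Rightarrow> bool" where
  "analytic_graph \<A> \<gamma> \<longleftrightarrow>
     (\<forall>e. analytic_edge \<A> (\<gamma> e)) \<and>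
     (\<forall>e e'. e \<noteq> e' \<longrightarrow>
        path_image (\<gamma> e) \<inter> path_image (\<gamma> e') \<subseteq>
          {pathstart (\<gamma> e), pathfinish (\<gamma> e)} \<inter> {pathstart (\<gamma> e'), pathfinish (\<gamma> e')})"

definition vertices :: "('e \<Rightarrow> real \<Rightarrow> 'a) \<Rightarrow> 'a::topological_space set" where
  "vertices \<gamma> = (\<Union>e. {pathstart (\<gamma> e), pathfinish (\<gamma> e)})"

definition edges_at :: "('e \<Rightarrow> real \<Rightarrow> 'a::topological_space) \<Rightarrow> 'a \<Rightarrow> 'e set" where
  "edges_at \<gamma> v = {e. v \<in> {pathstart (\<gamma> e), pathfinish (\<gamma> e)}}"


subsection \<open>Oriented surfaces through a vertex\<close>

text \<open>The orientation is recorded by the two local sides \<open>above\<close> and \<open>below\<close> of the surface.\<close>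

record ('a, 'k::finite) surface =
  face :: "real ^ 'k \<Rightarrow> 'a"
  above :: "'a set"
  below :: "'a set"

definition cube :: "(real ^ 'k::finite) set" where
  "cube = {x. \<forall>i. - 1 / 2 < x $ i \<and> x $ i < 1 / 2}"

definition embedded_face ::
    "('a::{t2_space,second_countable_topology}, 'd::finite) chart set \<Rightarrow> (real ^ 'k::finite \<Rightarrow> 'a) \<Rightarrow> bool" where
  "embedded_face \<A> F \<longleftrightarrow>
     homeomorphism cube (F ` cube) F (inv_into cube F) \<and>
     (\<forall>x\<in>cube. \<exists>(U, \<phi>)\<in>\<A>. F x \<in> U \<and> semianalytic_at (\<phi> \<circ> F) x \<and> C1_immersion_at (\<phi> \<circ> F) x)"

text \<open>Near \<open>v\<close>, the complement of an embedded hypersurface has exactly two local components.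
  The conditions below force one of them to be the germ of \<open>above\<close> and the other one to be the
  germ of \<open>below\<close>; hence there are, up to germs at \<open>v\<close>, exactly two orientations.\<close>

definition surface_through ::
    "('a::{t2_space,second_countable_topology}, 'd::finite) chart set \<Rightarrow> 'a \<Rightarrow> ('a, 'k::finite) surface \<Rightarrow> bool" where
  "surface_through \<A> v S \<longleftrightarrow>
     embedded_face \<A> (face S) \<and> face S 0 = v \<and>
     open (above S) \<and> open (below S) \<and> above S \<inter> below S = {} \<and>
     (above S \<union> below S) \<inter> face S ` cube = {} \<and>
     v \<in> interior (above S \<union> below S \<union> face S ` cube) \<and>
     v \<in> closure (above S) \<and> v \<in> closure (below S)"

definition type_indicator :: "(real \<Rightarrow> 'a) \<Rightarrow> ('a, 'k::finite) surface \<Rightarrow> int" where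
  "type_indicator e S =
     (if \<forall>\<^sub>F t in at_right 0. e t \<in> above S then 1
      else if \<forall>\<^sub>F t in at_right 0. e t \<in> below S then - 1
      else 0)"


subsection \<open>Cylindrical functions and right-invariant vector fields\<close>

text \<open>The group \<open>SO(D+1)\<^sup>E\<close> is a subset of the Euclidean space of families of matrices, and
  functions on it are represented by functions on that space whose other values are irrelevant.\<close>

definition SO_family :: "(real ^ 'n ^ 'n ^ 'e::finite) set" where
  "SO_family = {h. \<forall>e. rotation_matrix (h $ e)}"

text \<open>A function on a submanifold \<open>G\<close> of a Euclidean space is twice differentiable iff it is the
  restriction of a function that is twice (Frechet) differentiable on an open neighbourhood.\<close>

definition twice_differentiable_on_manifold ::
    "('a::euclidean_space \<Rightarrow> 'b::real_normed_vector) \<Rightarrow> 'a set \<Rightarrow> bool" where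
  "twice_differentiable_on_manifold f G \<longleftrightarrow>
     (\<exists>U F F'. open U \<and> G \<subseteq> U \<and> (\<forall>x\<in>G. F x = f x) \<and>
        (\<forall>x\<in>U. (F has_derivative blinfun_apply (F' x)) (at x)) \<and>
        (\<forall>x\<in>U. F' differentiable (at x)))"

primrec mat_power :: "real ^ 'n ^ 'n \<Rightarrow> nat \<Rightarrow> real ^ 'n ^ 'n" where
  "mat_power A 0 = mat 1"
| "mat_power A (Suc m) = A ** mat_power A m"

definition mat_exp :: "real ^ 'n ^ 'n \<Rightarrow> real ^ 'n ^ 'n" where
  "mat_exp A = (\<Sum>m. mat_power A m /\<^sub>R fact m)"

definition kronecker :: "'n \<Rightarrow> 'n \<Rightarrow> real" where
  "kronecker i j = (if i = j then 1 else 0)"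

definition so_basis :: "'n \<Rightarrow> 'n \<Rightarrow> real ^ 'n ^ 'n" where
  "so_basis I J = (\<chi> K L. 1 / 2 * (kronecker K I * kronecker J L - kronecker K J * kronecker I L))"

definition right_inv :: "'e \<Rightarrow> 'n \<Rightarrow> 'n \<Rightarrow>
    (real ^ 'n ^ 'n ^ 'e \<Rightarrow> complex) \<Rightarrow> real ^ 'n ^ 'n ^ 'e \<Rightarrow> complex" where
  "right_inv e I J F h =
     vector_derivative
       (\<lambda>t. F (\<chi> e'. if e' = e then mat_exp (t *\<^sub>R so_basis I J) ** h $ e' else h $ e')) (at 0)"


subsection \<open>Antisymmetrisation\<close>

text \<open>The totally antisymmetric symbol, with value 1 on the increasing list of all indices;
  the sign of a permutation is given by its number of inversions.\<close>

definition levi_civita :: "'n::{finite,linorder} list \<Rightarrow> int" where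
  "levi_civita is =
     (if distinct is \<and> set is = UNIV
      then (- 1) ^ card {(p, q). p < q \<and> q < length is \<and> is ! q < is ! p}
      else 0)"

definition antisym4 :: "('n \<Rightarrow> 'n \<Rightarrow> 'n \<Rightarrow> 'n \<Rightarrow> complex) \<Rightarrow> 'n \<Rightarrow> 'n \<Rightarrow> 'n \<Rightarrow> 'n \<Rightarrow> complex" where
  "antisym4 T I J K L =
     (\<Sum>p | p permutes {..<4::nat}. of_int (sign p) *
        (let X = (\<lambda>m. [I, J, K, L] ! p m) in T (X 0) (X 1) (X 2) (X 3))) / fact 4"

end

theory Submission
  imports Defs "HOL-Complex_Analysis.Complex_Analysis"
begin

text \<open>Contracting with the totally antisymmetric symbol for all \<open>M\<close> is equivalent to
  antisymmetrising, so the building blocks imply the constraints, and the converse follows once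
  the constraints can be localised at a single pair of edges.  For this, every edge \<open>e\<close> at \<open>v\<close>
  needs two surfaces whose type indicators differ at \<open>e\<close> but agree at all other edges.

  In a chart, let \<open>x\<close> be the coordinate along the tangent of \<open>e\<close> at \<open>v\<close> and \<open>z\<close> a coordinate in
  a generic perpendicular direction.  The surfaces are \<open>z = Q x\<close> with \<open>Q\<close> polynomial for \<open>x > 0\<close>
  and \<open>Q = 0\<close> for \<open>x \<le> 0\<close>.  Both surfaces have the same tangent plane, which decides the side of
  the edges transversal to it, and they coincide where the edges leave in the direction opposite
  to \<open>e\<close>.  An edge tangent to \<open>e\<close> is, like \<open>e\<close> itself, a graph over \<open>x\<close> that has a holomorphic
  extension; as different edges do not overlap, and as \<open>z\<close> is generic, the \<open>z\<close>-coordinates of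
  the two graphs differ at a finite order.  Hence two polynomials that pinch \<open>e\<close> from both sides at
  a sufficiently high order leave all other edges on the same side.\<close>

subsection \<open>The totally antisymmetric symbol\<close>

text \<open>Flattening the surfaces for \<open>x \<le> 0\<close> deals with an edge that continues
  \<open>e\<close> analytically through \<open>v\<close>. If the perturbations used to pinch
  \<open>e\<close> were present on both sides of \<open>x = 0\<close>, they would change the type
  indicator of that continuation as well. The price is that the surface is only glued from two
  analytic pieces. The tangent of \<open>e\<close> is perpendicular to the \<open>z\<close>
  direction, so the \<open>z\<close>-coordinate of \<open>e\<close> as a function of
  \<open>x\<close> vanishes to second order. Every profile can therefore carry a factor
  \<open>x^2\<close>, which makes the gluing continuously differentiable and keeps the tangent plane
  fixed.

  Generic means outside finitely many proper subspaces: one per transversal edge, and one per edge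
  leaving in the same direction as \<open>e\<close>. Edges leaving in the opposite direction need no
  condition, because indicators only have to agree between the two surfaces and may be zero.

  Holomorphic extensions supply two facts: an inverse of \<open>x\<close> along an edge that is
  again analytic, and a finite order of vanishing for a non-zero difference of two profiles. This
  order bounds how fine the pinching must be.\<close>

lemma antisym4_expand:
  "antisym4 T I J K L =
    (T I J K L - T J I K L - T K J I L - T L J K I - T I K J L - T I L K J - T I J L K
     + T J K I L + T K I J L + T J L K I + T L I K J + T K J L I + T L J I K + T I K L J + T I L J K
     + T J I L K + T K L I J + T L K J I
     - T J K L I - T J L I K - T K I L J - T K L J I - T L I J K - T L K I J) / 24"
proof -
  have set4: "{..<4::nat} = {0, 1, 2, 3}" by auto
  have f: "finite {1, 2, 3::nat}" "0 \<notin> {1, 2, 3::nat}" "finite {2, 3::nat}" "1 \<notin> {2, 3::nat}"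
    "finite {3::nat}" "2 \<notin> {3::nat}" by auto
  \<comment> \<open>Inserting one point at a time writes every permutation as a product of
    transpositions, so its sign can be evaluated by rewriting. The 24 terms are listed by cycle
    type: identity, 6 transpositions, 8 three-cycles, 3 double transpositions, 6
    four-cycles.\<close>
  show ?thesis
    unfolding antisym4_def set4
    unfolding sum_over_permutations_insert[OF f(1,2)] sum_over_permutations_insert[OF f(3,4)]
      sum_over_permutations_insert[OF f(5,6)] permutes_sing
    apply (simp add: sign_compose permutation_swap_id permutation_compose sign_swap_id Let_def
      Transposition.transpose_def fact_numeral)
    done
qed

text \<open>A recursive form of the inversion sign in \<open>levi_civita\<close>; the recursion
  makes induction over a common prefix possible.\<close>

primrec order_sign :: "'n::linorder list \<Rightarrow> int" where
  "order_sign [] = 1"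
| "order_sign (x # xs) = prod_list (map (\<lambda>y. if y < x then - 1 else 1) xs) * order_sign xs"

text \<open>The inversions of \<open>x # xs\<close> split into those involving position 0, which are
  counted by the entries of \<open>xs\<close> below \<open>x\<close>, and the shifted inversions of
  \<open>xs\<close>.\<close>

lemma order_sign_inversions:
  "order_sign xs = (- 1) ^ card {(p, q). p < q \<and> q < length xs \<and> xs ! q < xs ! p}"
proof (induction xs)
  case (Cons x xs)
  let ?S = "\<lambda>xs. {(p, q). p < q \<and> q < length xs \<and> xs ! q < xs ! p}"
  let ?A = "(\<lambda>q. (0::nat, Suc q)) ` {q. q < length xs \<and> xs ! q < x}"
  let ?B = "map_prod Suc Suc ` ?S xs"
  have fin: "finite (?S xs)"
    by (rule finite_subset[of _ "{..<length xs} \<times> {..<length xs}"]) auto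
  have eq: "?S (x # xs) = ?A \<union> ?B"
  proof (intro set_eqI iffI)
    fix z assume z: "z \<in> ?S (x # xs)"
    obtain p q where pq: "z = (p, q)" by (cases z)
    from z pq obtain q' where q': "q = Suc q'" by (cases q) auto
    show "z \<in> ?A \<union> ?B"
    proof (cases p)
      case 0 then show ?thesis using z pq q' by auto
    next
      case (Suc p')
      have "(p', q') \<in> ?S xs" using z pq q' Suc by auto
      then have "map_prod Suc Suc (p', q') \<in> ?B" by blast
      then show ?thesis using pq q' Suc by auto
    qed
  qed auto
  have "card (?S (x # xs)) = card ?A + card ?B"
    unfolding eq by (rule card_Un_disjoint) (use fin in auto)
  also have "card ?A = card {q. q < length xs \<and> xs ! q < x}"
    by (rule card_image) (auto simp: inj_on_def)
  also have "\<dots> = length (filter (\<lambda>y. y < x) xs)"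
    by (simp add: length_filter_conv_card)
  also have "card ?B = card (?S xs)"
    by (rule card_image) (auto simp: inj_on_def)
  finally have c: "card (?S (x # xs)) = length (filter (\<lambda>y. y < x) xs) + card (?S xs)" .
  have "prod_list (map (\<lambda>y. if y < x then - 1 else 1) xs) = (- 1 :: int) ^ length (filter (\<lambda>y. y < x) xs)"
    by (induction xs) auto
  then show ?case using c Cons.IH by (simp add: power_add)
qed auto

lemma levi_civita_order_sign:
  "levi_civita xs = (if distinct xs \<and> set xs = UNIV then order_sign xs else 0)"
  by (simp add: levi_civita_def order_sign_inversions)

text \<open>A prefix entry contributes a product over all later entries, which does not see their
  order. Only the comparison of \<open>a\<close> with \<open>b\<close> changes, and it changes sign
  as long as they differ; if they coincide, both sides are zero.\<close>

lemma levi_civita_swap: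
  "levi_civita (xs @ a # b # ys) = - levi_civita (xs @ b # a # ys)"
proof (cases "a = b")
  case False
  have "order_sign (xs @ a # b # ys) = - order_sign (xs @ b # a # ys)"
  proof (induction xs)
    case Nil
    then show ?case using False by auto
  next
    case (Cons x xs)
    then show ?case by simp
  qed
  then show ?thesis by (auto simp: levi_civita_order_sign insert_commute)
next
  case True
  then show ?thesis by (simp add: levi_civita_def)
qed

lemma levi_civita_swaps:
  "levi_civita (b # a # c # d # M) = - levi_civita (a # b # c # d # M)"
  "levi_civita (a # c # b # d # M) = - levi_civita (a # b # c # d # M)"
  "levi_civita (a # b # d # c # M) = - levi_civita (a # b # c # d # M)"
  using levi_civita_swap[of "[]" b a "c # d # M"] levi_civita_swap[of "[a]" c b "d # M"]
    levi_civita_swap[of "[a, b]" d c M] by simp_all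

text \<open>All 23 non-trivial rearrangements are reached by adjacent swaps. They are listed by
  cycle type, as in \<open>antisym4_expand\<close>.\<close>

lemma levi_civita_perms:
  fixes a b c d :: "'n::{finite,linorder}" and M :: "'n list"
  defines "s \<equiv> levi_civita (a # b # c # d # M)"
  shows
  "levi_civita (b # a # c # d # M) = - s" "levi_civita (c # b # a # d # M) = - s"
  "levi_civita (d # b # c # a # M) = - s" "levi_civita (a # c # b # d # M) = - s"
  "levi_civita (a # d # c # b # M) = - s" "levi_civita (a # b # d # c # M) = - s"
  "levi_civita (b # c # a # d # M) = s" "levi_civita (c # a # b # d # M) = s"
  "levi_civita (b # d # c # a # M) = s" "levi_civita (d # a # c # b # M) = s"
  "levi_civita (c # b # d # a # M) = s" "levi_civita (d # b # a # c # M) = s"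
  "levi_civita (a # c # d # b # M) = s" "levi_civita (a # d # b # c # M) = s"
  "levi_civita (b # a # d # c # M) = s" "levi_civita (c # d # a # b # M) = s"
  "levi_civita (d # c # b # a # M) = s"
  "levi_civita (b # c # d # a # M) = - s" "levi_civita (b # d # a # c # M) = - s"
  "levi_civita (c # a # d # b # M) = - s" "levi_civita (c # d # b # a # M) = - s"
  "levi_civita (d # a # b # c # M) = - s" "levi_civita (d # c # a # b # M) = - s"
  unfolding s_def
  using levi_civita_swaps[where ?'a = 'n]
  by (smt (verit, ccfv_threshold))+

lemma levi_civita_not_distinct: "\<not> distinct xs \<Longrightarrow> levi_civita xs = 0"
  by (simp add: levi_civita_def)

lemma antisym4_not_distinct: "\<not> distinct [I, J, K, L] \<Longrightarrow> antisym4 T I J K L = 0"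
  unfolding antisym4_expand by auto

text \<open>By counting, \<open>M\<close> and \<open>I, J, K, L\<close> together exhaust the index
  type. A summand in which an index lies outside \<open>{I, J, K, L}\<close> repeats an entry of
  \<open>M\<close> and vanishes, so exactly the 24 permutations survive; the factor 24 cancels the
  normalisation of \<open>antisym4\<close>.\<close>

lemma levi_civita_contract:
  fixes I J K L :: "'n::{finite,linorder}" and M :: "'n list"
  assumes dist: "distinct ([I, J, K, L] @ M)" and len: "length M + 4 = CARD('n)"
  shows "(\<Sum>i\<in>UNIV. \<Sum>j\<in>UNIV. \<Sum>k\<in>UNIV. \<Sum>l\<in>UNIV. of_int (levi_civita ([i, j, k, l] @ M)) * T i j k l)
    = 24 * of_int (levi_civita ([I, J, K, L] @ M)) * antisym4 T I J K L"
proof -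
  let ?S = "{I, J, K, L}"
  let ?e = "\<lambda>i j k l. of_int (levi_civita ([i, j, k, l] @ M)) :: complex"
  have "card (set ([I, J, K, L] @ M)) = CARD('n)"
    using distinct_card[OF dist] len by simp
  then have U: "set ([I, J, K, L] @ M) = UNIV"
    by (metis card_subset_eq finite subset_UNIV)
  have z: "?e i j k l = 0" if "i \<notin> ?S \<or> j \<notin> ?S \<or> k \<notin> ?S \<or> l \<notin> ?S" for i j k l
  proof -
    have "i \<in> set M \<or> j \<in> set M \<or> k \<in> set M \<or> l \<in> set M" using that U by auto
    then have "\<not> distinct ([i, j, k, l] @ M)" by auto
    then show ?thesis by (simp add: levi_civita_not_distinct)
  qed
  have red: "(\<Sum>i\<in>UNIV. G i) = (\<Sum>i\<in>?S. G i)" if "\<And>i. i \<notin> ?S \<Longrightarrow> G i = 0" for G :: "'n \<Rightarrow> complex"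
    by (rule sum.mono_neutral_right) (use that in auto)
  have "(\<Sum>i\<in>UNIV. \<Sum>j\<in>UNIV. \<Sum>k\<in>UNIV. \<Sum>l\<in>UNIV. ?e i j k l * T i j k l)
    = (\<Sum>i\<in>?S. \<Sum>j\<in>UNIV. \<Sum>k\<in>UNIV. \<Sum>l\<in>UNIV. ?e i j k l * T i j k l)"
    by (rule red) (intro sum.neutral ballI; subst z; blast?; simp)
  also have "\<dots> = (\<Sum>i\<in>?S. \<Sum>j\<in>?S. \<Sum>k\<in>UNIV. \<Sum>l\<in>UNIV. ?e i j k l * T i j k l)"
    by (intro sum.cong refl red) (intro sum.neutral ballI; subst z; blast?; simp)
  also have "\<dots> = (\<Sum>i\<in>?S. \<Sum>j\<in>?S. \<Sum>k\<in>?S. \<Sum>l\<in>UNIV. ?e i j k l * T i j k l)"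
    by (intro sum.cong refl red) (intro sum.neutral ballI; subst z; blast?; simp)
  also have "\<dots> = (\<Sum>i\<in>?S. \<Sum>j\<in>?S. \<Sum>k\<in>?S. \<Sum>l\<in>?S. ?e i j k l * T i j k l)"
    by (intro sum.cong refl red) (subst z; blast?; simp)
  also have "\<dots> = 24 * ?e I J K L * antisym4 T I J K L"
    unfolding antisym4_expand
    using dist
    apply (simp add: levi_civita_not_distinct)
    apply (simp add: levi_civita_perms[where a=I and b=J and c=K and d=L and M=M])
    apply (simp add: algebra_simps)
    done
  finally show ?thesis .
qed

text \<open>Purely algebraic in \<open>T\<close>, hence applicable pointwise to the second
  derivatives at each group element and for each pair of edges.\<close>

lemma antisym4_eq_0_iff_contractions:
  fixes T :: "'n::{finite,linorder} \<Rightarrow> 'n \<Rightarrow> 'n \<Rightarrow> 'n \<Rightarrow> complex"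
  assumes m: "m + 4 = CARD('n)"
  shows "(\<forall>I J K L. antisym4 T I J K L = 0) \<longleftrightarrow>
    (\<forall>M. length M = m \<longrightarrow> (\<Sum>i\<in>UNIV. \<Sum>j\<in>UNIV. \<Sum>k\<in>UNIV. \<Sum>l\<in>UNIV.
      of_int (levi_civita ([i, j, k, l] @ M)) * T i j k l) = 0)" (is "?L \<longleftrightarrow> ?R")
proof
  assume L: ?L
  show ?R
  proof (intro allI impI)
    fix M :: "'n list" assume M: "length M = m"
    show "(\<Sum>i\<in>UNIV. \<Sum>j\<in>UNIV. \<Sum>k\<in>UNIV. \<Sum>l\<in>UNIV.
      of_int (levi_civita ([i, j, k, l] @ M)) * T i j k l) = 0"
    proof (cases "\<exists>I J K L. distinct ([I, J, K, L] @ M)")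
      case True
      then obtain I J K L where d: "distinct ([I, J, K, L] @ M)" by blast
      show ?thesis
        by (subst levi_civita_contract[OF d]) (use m M L in auto)
    next
      case False
      then have "levi_civita ([i, j, k, l] @ M) = 0" for i j k l
        by (intro levi_civita_not_distinct) blast
      then show ?thesis by simp
    qed
  qed
next
  assume R: ?R
  show ?L
  proof (intro allI)
    fix I J K L
    show "antisym4 T I J K L = 0"
    proof (cases "distinct [I, J, K, L]")
      case True
      \<comment> \<open>The complement of the four indices is the multi-index whose contraction
        isolates this one component.\<close>
      define M where "M = sorted_list_of_set (- {I, J, K, L})"
      have "card (- {I, J, K, L}) = CARD('n) - card {I, J, K, L}"
        unfolding Compl_eq_Diff_UNIV by (rule card_Diff_subset) auto
      also have "card {I, J, K, L} = 4" using distinct_card[OF True] by simp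
      finally have M: "length M = m" using m by (simp add: M_def)
      have d: "distinct ([I, J, K, L] @ M)" and U: "set ([I, J, K, L] @ M) = UNIV"
        using True by (auto simp: M_def)
      have "24 * of_int (levi_civita ([I, J, K, L] @ M)) * antisym4 T I J K L = 0"
        by (subst levi_civita_contract[OF d, symmetric]) (use m M R in auto)
      moreover have "levi_civita ([I, J, K, L] @ M) \<noteq> 0"
        using d U by (simp add: levi_civita_def)
      ultimately show ?thesis by auto
    qed (rule antisym4_not_distinct)
  qed
qed

subsection \<open>Germs of real functions with a holomorphic extension\<close>

text \<open>The real function is constrained only near 0, but on both sides of it. The extension
  gives access to factorisation of zeros and to inversion, while statements stay about real
  functions.\<close>

definition hol_germ :: "(real \<Rightarrow> real) \<Rightarrow> bool" where
  "hol_germ h \<longleftrightarrow> (\<exists>r>0. \<exists>H. H holomorphic_on ball 0 r \<and> (\<forall>t. \<bar>t\<bar> < r \<longrightarrow> H (of_real t) = of_real (h t)))"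

lemma hol_germI:
  assumes "r > 0" "H holomorphic_on ball 0 r" "\<And>t. \<bar>t\<bar> < r \<Longrightarrow> H (of_real t) = of_real (h t)"
  shows "hol_germ h"
  using assms unfolding hol_germ_def by blast

lemma hol_germE:
  assumes "hol_germ h"
  obtains r H where "r > 0" "H holomorphic_on ball 0 r" "\<And>t. \<bar>t\<bar> < r \<Longrightarrow> H (of_real t) = of_real (h t)"
  using assms unfolding hol_germ_def by blast

lemma hol_germ_const: "hol_germ (\<lambda>t. c)"
  by (rule hol_germI[of 1 "\<lambda>z. of_real c"]) auto

lemma hol_germ_diff:
  assumes f: "hol_germ f" and g: "hol_germ g"
  shows "hol_germ (\<lambda>t. f t - g t)"
proof -
  obtain r F where F: "r > 0" "F holomorphic_on ball 0 r" "\<And>t. \<bar>t\<bar> < r \<Longrightarrow> F (of_real t) = of_real (f t)"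
    using f by (elim hol_germE) blast
  obtain s G where G: "s > 0" "G holomorphic_on ball 0 s" "\<And>t. \<bar>t\<bar> < s \<Longrightarrow> G (of_real t) = of_real (g t)"
    using g by (elim hol_germE) blast
  have "F holomorphic_on ball 0 (min r s)" "G holomorphic_on ball 0 (min r s)"
    using F(2) G(2) by (auto intro: holomorphic_on_subset)
  then show ?thesis
    using F(1,3) G(1,3) by (intro hol_germI[OF _ holomorphic_on_diff[of F _ G]]) auto
qed

lemma holomorphic_ball_isCont: "G holomorphic_on ball 0 r \<Longrightarrow> r > 0 \<Longrightarrow> isCont G 0"
  using holomorphic_on_imp_continuous_on[of G "ball 0 r"] by (simp add: continuous_on_eq_continuous_at)

lemma hol_germ_compose:
  assumes f: "hol_germ f" and g: "hol_germ g" and g0: "g 0 = 0"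
  shows "hol_germ (\<lambda>t. f (g t))"
proof -
  obtain r F where F: "r > 0" "F holomorphic_on ball 0 r" "\<And>t. \<bar>t\<bar> < r \<Longrightarrow> F (of_real t) = of_real (f t)"
    using f by (elim hol_germE) blast
  obtain s G where G: "s > 0" "G holomorphic_on ball 0 s" "\<And>t. \<bar>t\<bar> < s \<Longrightarrow> G (of_real t) = of_real (g t)"
    using g by (elim hol_germE) blast
  have "isCont G 0"
    using G(2,1) by (rule holomorphic_ball_isCont)
  moreover have "G 0 = 0" using G(3)[of 0] G(1) g0 by simp
  ultimately obtain d where d: "d > 0" "\<And>z. dist z 0 < d \<Longrightarrow> dist (G z) 0 < r"
    using F(1) unfolding continuous_at_eps_delta by metis
  let ?e = "min s d"
  have "G ` ball 0 ?e \<subseteq> ball 0 r" using d(2) by (auto simp: dist_commute)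
  moreover have "G holomorphic_on ball 0 ?e" by (rule holomorphic_on_subset[OF G(2)]) auto
  ultimately have "(F \<circ> G) holomorphic_on ball 0 ?e"
    using F(2) by (meson holomorphic_on_compose holomorphic_on_subset)
  then show ?thesis
  proof (rule hol_germI[rotated])
    show "(F \<circ> G) (of_real t) = of_real (f (g t))" if "\<bar>t\<bar> < ?e" for t
    proof -
      have "dist (G (of_real t)) 0 < r" using d(2)[of "of_real t"] that by simp
      then show ?thesis using F(3)[of "g t"] G(3)[of t] that by simp
    qed
  qed (use G(1) d(1) in auto)
qed

lemma tendsto_of_real_at_right_0: "((\<lambda>t. complex_of_real t) \<longlongrightarrow> 0) (at_right 0)"
  using tendsto_of_real[OF tendsto_ident_at, of 0 "{0<..}"] by simp

text \<open>Quotients of real-valued extensions are visibly real only away from 0; closedness of the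
  reals carries this over to 0.\<close>

lemma Reals_at_0:
  fixes G :: "complex \<Rightarrow> complex"
  assumes cont: "isCont G 0" and r: "r > 0"
    and real: "\<And>t. 0 < t \<Longrightarrow> t < r \<Longrightarrow> G (of_real t) \<in> \<real>"
  shows "G 0 \<in> \<real>"
proof (rule Lim_in_closed_set[OF closed_complex_Reals])
  show "((\<lambda>t. G (of_real t)) \<longlongrightarrow> G 0) (at_right (0::real))"
    by (rule isCont_tendsto_compose[OF cont tendsto_of_real_at_right_0])
  show "\<forall>\<^sub>F t in at_right (0::real). G (of_real t) \<in> \<real>"
    using eventually_at_right_less[of "0::real"] eventually_at_right_real[OF r]
    by eventually_elim (use real in auto)
qed simp

lemma hol_germ_factor:
  assumes "hol_germ h"
  obtains h1 where "hol_germ h1" "\<And>t. h t = h 0 + t * h1 t"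
proof -
  obtain r H where H: "r > 0" "H holomorphic_on ball 0 r" "\<And>t. \<bar>t\<bar> < r \<Longrightarrow> H (of_real t) = of_real (h t)"
    using assms by (elim hol_germE) blast
  have "(\<lambda>z. H z - H 0) holomorphic_on ball 0 r" by (intro holomorphic_intros H)
  then obtain G where G: "G holomorphic_on ball 0 r" "\<And>z. norm z < r \<Longrightarrow> H z - H 0 = z * G z"
    by (rule Schwarz3) auto
  \<comment> \<open>The quotient is taken on the whole real line, so that the factorisation holds
    for every \<open>t\<close> and not only near 0. At 0 the value is prescribed by the holomorphic
    quotient, which turns out to be real there.\<close>
  define h1 where "h1 t = (if t = 0 then Re (G 0) else (h t - h 0) / t)" for t
  have eq: "G (of_real t) = of_real (h1 t)" if "\<bar>t\<bar> < r" "t \<noteq> 0" for t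
    using G(2)[of "of_real t"] H(1) H(3)[OF that(1)] H(3)[of 0] that
    by (auto simp: h1_def field_simps)
  have "isCont G 0"
    using G(1) H(1) by (rule holomorphic_ball_isCont)
  then have "G 0 \<in> \<real>"
    by (rule Reals_at_0[OF _ H(1)]) (use eq in auto)
  then have "G 0 = of_real (h1 0)" by (simp add: h1_def)
  have "hol_germ h1"
  proof (rule hol_germI[OF H(1) G(1)])
    show "G (of_real t) = of_real (h1 t)" if "\<bar>t\<bar> < r" for t
      using eq[OF that] \<open>G 0 = of_real (h1 0)\<close> by (cases "t = 0") auto
  qed
  then show ?thesis by (rule that) (simp add: h1_def)
qed

lemma hol_germ_continuous:
  assumes "hol_germ h"
  obtains r where "r > 0" "continuous_on {- r<..<r} h"
proof -
  obtain r H where H: "r > 0" "H holomorphic_on ball 0 r" "\<And>t. \<bar>t\<bar> < r \<Longrightarrow> H (of_real t) = of_real (h t)"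
    using assms by (elim hol_germE) blast
  have "continuous_on {- r<..<r} (\<lambda>t. Re (H (of_real t)))"
    by (intro continuous_intros continuous_on_compose2[OF holomorphic_on_imp_continuous_on[OF H(2)]]) auto
  moreover have "Re (H (of_real t)) = h t" if "t \<in> {- r<..<r}" for t
    using H(3)[of t] that by auto
  ultimately have "continuous_on {- r<..<r} h"
    by (subst continuous_on_cong[OF refl, of _ _ "\<lambda>t. Re (H (of_real t))"]) auto
  with H(1) show ?thesis by (rule that)
qed

lemma hol_germ_isCont: "hol_germ h \<Longrightarrow> isCont h 0"
  by (erule hol_germ_continuous) (simp add: continuous_on_eq_continuous_at)

lemma hol_germ_derivative:
  assumes "hol_germ h1" "\<And>t. h t = h 0 + t * h1 t"
  shows "(h has_real_derivative h1 0) (at 0)"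
proof -
  have "(h1 \<longlongrightarrow> h1 0) (at 0)" using hol_germ_isCont[OF assms(1)] by (simp add: isCont_def)
  then have "((\<lambda>t. (h t - h 0) / (t - 0)) \<longlongrightarrow> h1 0) (at 0)"
  proof (rule Lim_transform_eventually)
    show "\<forall>\<^sub>F t in at 0. h1 t = (h t - h 0) / (t - 0)"
      unfolding eventually_at_filter
      by (rule always_eventually) (intro allI impI, metis add_diff_cancel_left' assms(2) diff_zero nonzero_mult_div_cancel_left)
  qed
  then show ?thesis by (simp add: has_field_derivative_iff)
qed

text \<open>Unless it vanishes identically, the extension is \<open>w ^ n * G w\<close> with
  \<open>G 0\<close> non-zero. \<open>G 0\<close> is real, and its sign decides which of the two
  one-sided bounds holds.\<close>

lemma hol_germ_order:
  assumes h: "hol_germ h"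
  shows "(\<forall>\<^sub>F t in at_right 0. h t = 0) \<or>
    (\<exists>c>0. \<exists>q. (\<forall>\<^sub>F t in at_right 0. h t \<ge> c * t ^ q) \<or> (\<forall>\<^sub>F t in at_right 0. h t \<le> - (c * t ^ q)))"
proof -
  obtain r H where H: "r > 0" "H holomorphic_on ball 0 r" "\<And>t. \<bar>t\<bar> < r \<Longrightarrow> H (of_real t) = of_real (h t)"
    using h by (elim hol_germE) blast
  have small: "\<forall>\<^sub>F t in at_right 0. 0 < t \<and> t < s" if "s > 0" for s :: real
    using eventually_at_right_less[of "0::real"] eventually_at_right_real[OF that] by eventually_elim auto
  show ?thesis
  proof (cases "\<forall>z\<in>ball 0 r. H z = 0")
    case True
    have "\<forall>\<^sub>F t in at_right 0. h t = 0"
      using small[OF H(1)] by eventually_elim (use H(3) True in force)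
    then show ?thesis ..
  next
    case False
    note False' = this
    \<comment> \<open>The factorisation theorem for zeros applies when \<open>H 0 = 0\<close>;
      otherwise \<open>H\<close> itself serves, with exponent 0.\<close>
    have "\<exists>G s n. 0 < s \<and> G holomorphic_on ball 0 s \<and> (\<forall>w\<in>ball 0 s. H w = w ^ n * G w) \<and> G 0 \<noteq> 0"
    proof (cases "H 0 = 0")
      case True
      have "\<not> H constant_on ball 0 r"
      proof
        assume "H constant_on ball 0 r"
        then obtain k where "\<forall>z\<in>ball 0 r. H z = k" unfolding constant_on_def by blast
        moreover have "k = 0" using calculation True H(1) by (metis centre_in_ball)
        ultimately show False using False' by blast
      qed
      then obtain G s n where "0 < s" "G holomorphic_on ball 0 s"
          "\<And>w. w \<in> ball 0 s \<Longrightarrow> H w = (w - 0) ^ n * G w" "\<And>w. w \<in> ball 0 s \<Longrightarrow> G w \<noteq> 0"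
        using holomorphic_factor_zero_nonconstant[OF H(2) open_ball connected_ball _ True] H(1)
        by (metis centre_in_ball)
      then show ?thesis
        by (intro exI[of _ G] exI[of _ s] exI[of _ n]) auto
    next
      case False
      then show ?thesis
        using H(1,2) by (intro exI[of _ H] exI[of _ r] exI[of _ 0]) auto
    qed
    then obtain G s n where G: "0 < s" "G holomorphic_on ball 0 s" "\<And>w. w \<in> ball 0 s \<Longrightarrow> H w = w ^ n * G w"
      "G 0 \<noteq> 0" by blast
    have cont: "isCont G 0"
      using G(2,1) by (rule holomorphic_ball_isCont)
    have eq: "h t = t ^ n * Re (G (of_real t)) \<and> G (of_real t) \<in> \<real>" if "0 < t" "t < min r s" for t
    proof -
      have 1: "of_real (h t) = of_real (t ^ n) * G (of_real t)"
        using G(3)[of "of_real t"] H(3)[of t] that by simp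
      then have 2: "G (of_real t) = of_real (h t / t ^ n)" using that by (simp add: field_simps)
      then show ?thesis using that by simp
    qed
    have "G 0 \<in> \<real>"
      by (rule Reals_at_0[OF cont, of "min r s"]) (use eq H(1) G(1) in auto)
    then have nz: "Re (G 0) \<noteq> 0" using G(4) by (metis of_real_0 of_real_Re)
    have lim: "((\<lambda>t. Re (G (of_real t))) \<longlongrightarrow> Re (G 0)) (at_right (0::real))"
      by (rule tendsto_Re[OF isCont_tendsto_compose[OF cont tendsto_of_real_at_right_0]])
    have sm: "\<forall>\<^sub>F t in at_right 0. 0 < t \<and> t < min r s" using small[of "min r s"] H(1) G(1) by auto
    \<comment> \<open>Half of the leading coefficient, so that the limit of \<open>G\<close> at 0
      gives a bound on a neighbourhood.\<close>
    let ?c = "\<bar>Re (G 0)\<bar> / 2"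
    have "(\<forall>\<^sub>F t in at_right 0. h t \<ge> ?c * t ^ n) \<or> (\<forall>\<^sub>F t in at_right 0. h t \<le> - (?c * t ^ n))"
    proof (cases "Re (G 0) > 0")
      case True
      then have "\<forall>\<^sub>F t in at_right (0::real). Re (G (of_real t)) > ?c"
        by (intro order_tendstoD[OF lim]) auto
      with sm have "\<forall>\<^sub>F t in at_right 0. h t \<ge> ?c * t ^ n"
        by eventually_elim (use eq in \<open>auto simp: mult.commute intro!: mult_left_mono\<close>)
      then show ?thesis ..
    next
      case False
      then have "\<forall>\<^sub>F t in at_right (0::real). Re (G (of_real t)) < - ?c"
        using nz by (intro order_tendstoD[OF lim]) auto
      with sm have "\<forall>\<^sub>F t in at_right 0. h t \<le> - (?c * t ^ n)"
      proof eventually_elim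
        case (elim t)
        then have "t ^ n * Re (G (of_real t)) \<le> t ^ n * (- ?c)"
          by (intro mult_left_mono) auto
        then show ?case using eq[of t] elim by (simp add: mult.commute)
      qed
      then show ?thesis ..
    qed
    moreover have "?c > 0" using nz by simp
    ultimately show ?thesis by blast
  qed
qed

lemma hol_germ_Taylor:
  assumes "hol_germ h"
  obtains P g where "hol_germ g" "\<And>t. h t = poly P t + t ^ n * g t"
proof -
  have "\<exists>P g. hol_germ g \<and> (\<forall>t. h t = poly P t + t ^ n * g t)"
    using assms
  proof (induction n arbitrary: h)
    case 0
    then show ?case by (intro exI[of _ 0] exI[of _ h]) auto
  next
    case (Suc n)
    obtain h1 where h1: "hol_germ h1" "\<And>t. h t = h 0 + t * h1 t"
      by (rule hol_germ_factor[OF Suc.prems]) (rule that)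
    obtain P g where g: "hol_germ g" "\<forall>t. h1 t = poly P t + t ^ n * g t" using Suc.IH[OF h1(1)] by blast
    have "h t = poly (pCons (h 0) P) t + t ^ Suc n * g t" for t
      using h1(2)[of t] g(2)[rule_format, of t] by (simp add: algebra_simps)
    then show ?case
      using g(1) by (intro exI[of _ "pCons (h 0) P"] exI[of _ g] conjI allI)
  qed
  then show ?thesis using that by blast
qed

section \<open>Inversion of germs and passage from real power series to holomorphic
  functions\<close>

lemma DERIV_pos_sign:
  fixes x :: "real \<Rightarrow> real"
  assumes "(x has_real_derivative a) (at 0)" "x 0 = 0" "a > 0"
  shows "\<forall>\<^sub>F t in nhds 0. (x t > 0 \<longleftrightarrow> t > 0) \<and> (x t < 0 \<longleftrightarrow> t < 0)"
proof -
  have "((\<lambda>t. x t / t) \<longlongrightarrow> a) (at 0)"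
    using assms(1,2) by (simp add: has_field_derivative_iff)
  then have "\<forall>\<^sub>F t in at 0. x t / t > 0" using assms(3) by (rule order_tendstoD)
  then show ?thesis unfolding eventually_at_filter
    by eventually_elim (use assms(2) in \<open>force simp: zero_less_divide_iff\<close>)
qed

text \<open>The holomorphic extension is locally injective and has a holomorphic inverse
  \<open>G\<close>. What remains is that \<open>G\<close> maps reals to reals: the intermediate
  value theorem gives a real preimage of a small real \<open>w\<close>, and injectivity identifies
  it with \<open>G w\<close>.\<close>

lemma hol_germ_inverse:
  assumes x: "hol_germ x" and x0: "x 0 = 0" and der: "(x has_real_derivative a) (at 0)" "a > 0"
  obtains y where "hol_germ y" "y 0 = 0" "\<forall>\<^sub>F t in nhds 0. y (x t) = t" "\<forall>\<^sub>F t in nhds 0. x (y t) = t"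
proof -
  obtain r X where X: "r > 0" "X holomorphic_on ball 0 r" "\<And>t. \<bar>t\<bar> < r \<Longrightarrow> X (of_real t) = of_real (x t)"
    using x by (elim hol_germE) blast
  have X0: "X 0 = 0" using X(3)[of 0] X(1) x0 by simp
  obtain x1 where x1: "hol_germ x1" "\<And>t. x t = x 0 + t * x1 t"
    by (rule hol_germ_factor[OF x]) (rule that)
  have "x1 0 = a"
    using DERIV_unique[OF hol_germ_derivative[OF x1] der(1)] .
  obtain X1 where X1: "X1 holomorphic_on ball 0 r" "\<And>z. norm z < r \<Longrightarrow> X z = z * X1 z" "deriv X 0 = X1 0"
    using Schwarz3[OF X(2) X0] by blast
  \<comment> \<open>\<open>X1 0\<close> is the complex derivative at 0. Its real part is the limit
    of \<open>x1\<close> along the positive reals, which is \<open>a > 0\<close>.\<close>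
  have "X1 0 \<noteq> 0"
  proof
    assume 0: "X1 0 = 0"
    have "isCont X1 0"
      using X1(1) X(1) by (rule holomorphic_ball_isCont)
    then have "((\<lambda>t. X1 (complex_of_real t)) \<longlongrightarrow> X1 0) (at_right 0)"
      by (rule isCont_tendsto_compose[OF _ tendsto_of_real_at_right_0])
    then have "((\<lambda>t. Re (X1 (complex_of_real t))) \<longlongrightarrow> Re (X1 0)) (at_right 0)" by (rule tendsto_Re)
    moreover have "\<forall>\<^sub>F t in at_right 0. Re (X1 (complex_of_real t)) = x1 t"
      using eventually_at_right_less[of "0::real"] eventually_at_right_real[OF X(1)]
    proof eventually_elim
      case (elim t)
      then have "of_real (t * x1 t) = of_real t * X1 (of_real t)"
        using X(3)[of t] X1(2)[of "of_real t"] x1(2)[of t] x0 by simp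
      then have "X1 (of_real t) = of_real (x1 t)" using elim by simp
      then show ?case by simp
    qed
    ultimately have "(x1 \<longlongrightarrow> 0) (at_right 0)"
      using 0 by (simp add: tendsto_cong)
    moreover have "(x1 \<longlongrightarrow> a) (at_right 0)"
      using hol_germ_isCont[OF x1(1)] \<open>x1 0 = a\<close> by (auto simp: isCont_def intro: tendsto_within_subset)
    ultimately have "a = 0" by (intro tendsto_unique[OF trivial_limit_at_right_real])
    with der(2) show False by simp
  qed
  with X1(3) have dn: "deriv X 0 \<noteq> 0" by simp
  have b0: "0 \<in> ball (0::complex) r" using X(1) by simp
  obtain s where s: "s > 0" "ball (0::complex) s \<subseteq> ball 0 r" "inj_on X (ball 0 s)"
    by (rule has_complex_derivative_locally_injective[OF X(2) b0 open_ball dn]) (rule that)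
  have Xs: "X holomorphic_on ball 0 s" using X(2) s(2) holomorphic_on_subset by blast
  obtain G where G: "G holomorphic_on X ` ball 0 s" "\<And>z. z \<in> ball 0 s \<Longrightarrow> G (X z) = z"
    using holomorphic_has_inverse[OF Xs open_ball s(3)] by metis
  have sr: "s \<le> r" using s(1,2) by (simp add: ball_subset_ball_iff)
  have "open (X ` ball 0 s)" by (rule open_mapping_thm3[OF Xs open_ball s(3)])
  moreover have "0 \<in> X ` ball 0 s" using X0 s(1) by (metis centre_in_ball imageI)
  ultimately obtain \<rho> where \<rho>: "\<rho> > 0" "ball 0 \<rho> \<subseteq> X ` ball 0 s" by (meson openE)
  obtain d where d: "d > 0" "\<And>t. \<bar>t\<bar> < d \<Longrightarrow> (x t > 0 \<longleftrightarrow> t > 0) \<and> (x t < 0 \<longleftrightarrow> t < 0)"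
    using DERIV_pos_sign[OF der(1) x0 der(2)] unfolding eventually_nhds_metric by auto
  obtain c where c: "c > 0" "continuous_on {- c<..<c} x" using hol_germ_continuous[OF x] .
  \<comment> \<open>On the interval from \<open>- s'\<close> to \<open>s'\<close> the function
    \<open>x\<close> is continuous, its signs at the ends are known, and the extension is injective.
    Below, \<open>\<rho>'\<close> keeps \<open>w\<close> between the two end values and inside the
    domain of \<open>G\<close>.\<close>
  define s' where "s' = min (min d c) s / 2"
  have s': "s' > 0" "s' < d" "s' < c" "s' < s" using d(1) c(1) s(1) by (auto simp: s'_def)
  define \<rho>' where "\<rho>' = min \<rho> (min (x s') (- x (- s')))"
  have \<rho>': "\<rho>' > 0" using d(2)[of s'] d(2)[of "- s'"] s' \<rho>(1) by (auto simp: \<rho>'_def)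
  have real: "\<exists>t. \<bar>t\<bar> < s \<and> x t = w \<and> G (of_real w) = of_real t" if "\<bar>w\<bar> < \<rho>'" for w
  proof -
    have "\<exists>t\<ge>- s'. t \<le> s' \<and> x t = w"
      by (rule IVT') (use that s' in \<open>auto simp: \<rho>'_def intro: continuous_on_subset[OF c(2)]\<close>)
    then obtain t where t': "- s' \<le> t" "t \<le> s'" "x t = w" by blast
    then have t: "\<bar>t\<bar> \<le> s'" "x t = w" by linarith+
    then have "X (of_real t) = of_real w" using X(3)[of t] s' sr by auto
    moreover have "of_real t \<in> ball (0::complex) s" using t s' by simp
    ultimately have "G (of_real w) = of_real t" using G(2) by metis
    then show ?thesis using t s' by (intro exI[of _ t]) auto
  qed
  define y where "y t = Re (G (of_real t))" for t
  have "hol_germ y"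
  proof (rule hol_germI[OF \<rho>'])
    show "G holomorphic_on ball 0 \<rho>'"
      by (rule holomorphic_on_subset[OF G(1)]) (use \<rho>(2) in \<open>auto simp: \<rho>'_def\<close>)
    show "G (of_real t) = of_real (y t)" if "\<bar>t\<bar> < \<rho>'" for t
      using real[OF that] by (auto simp: y_def)
  qed
  moreover have "y 0 = 0" using G(2)[of 0] X0 s(1) by (simp add: y_def)
  moreover have "\<forall>\<^sub>F t in nhds 0. y (x t) = t"
    unfolding eventually_nhds_metric
  proof (intro exI[of _ s] conjI allI impI s(1))
    fix t assume "dist t (0::real) < s"
    then have "G (of_real (x t)) = of_real t" using G(2)[of "of_real t"] X(3)[of t] sr by simp
    then show "y (x t) = t" by (simp add: y_def)
  qed
  moreover have "\<forall>\<^sub>F t in nhds 0. x (y t) = t"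
    unfolding eventually_nhds_metric
  proof (intro exI[of _ \<rho>'] conjI allI impI \<rho>')
    fix t assume "dist t (0::real) < \<rho>'"
    then show "x (y t) = t" using real[of t] by (auto simp: y_def)
  qed
  ultimately show ?thesis by (rule that)
qed

text \<open>The only basis vector of the reals is 1, so multi-indices amount to naturals via
  \<open>j\<close>, and the real coefficients define a complex power series with the same
  radius.\<close>

lemma real_analytic_hol_germ:
  fixes g :: "real \<Rightarrow> 'b::euclidean_space"
  assumes "real_analytic_at g 0"
  shows "hol_germ (\<lambda>t. g t \<bullet> b)"
proof -
  from assms[unfolded real_analytic_at_def] obtain r c where r: "r > 0" and
    c: "\<forall>y\<in>ball 0 r. ((\<lambda>\<alpha>. (\<Prod>b\<in>Basis. ((y - 0) \<bullet> b) ^ \<alpha> b) *\<^sub>R c \<alpha>) has_sum g y) (Basis \<rightarrow>\<^sub>E (UNIV :: nat set))"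
    by (elim exE conjE) (rule that)
  define j where "j m = (\<lambda>x\<in>{1::real}. m)" for m :: nat
  have bij: "bij_betw j UNIV (Basis \<rightarrow>\<^sub>E (UNIV :: nat set))"
  proof (rule bij_betwI[where g = "\<lambda>\<alpha>. \<alpha> 1"])
    show "j (\<alpha> 1) = \<alpha>" if "\<alpha> \<in> Basis \<rightarrow>\<^sub>E UNIV" for \<alpha>
      using that by (auto simp: j_def fun_eq_iff PiE_def extensional_def)
  qed (auto simp: j_def PiE_def extensional_def)
  define a where "a m = c (j m) \<bullet> b" for m
  have s: "(\<lambda>m. a m * y ^ m) sums (g y \<bullet> b)" if "\<bar>y\<bar> < r" for y
  proof -
    have "((\<lambda>m. y ^ m *\<^sub>R c (j m)) has_sum g y) UNIV"
      using has_sum_reindex_bij_betw[OF bij, THEN iffD2, OF bspec[OF c, of y]] that by (simp add: j_def)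
    then have "(\<lambda>m. y ^ m *\<^sub>R c (j m)) sums g y" by (rule has_sum_imp_sums)
    from bounded_linear.sums[OF bounded_linear_inner_left this, of b]
    show ?thesis by (simp add: a_def mult.commute)
  qed
  define H where "H z = (\<Sum>m. of_real (a m) * z ^ m)" for z :: complex
  have Hs: "(\<lambda>m. of_real (a m) * (z - 0) ^ m) sums H z" if "z \<in> ball 0 r" for z
  proof -
    have "norm z < r" using that by simp
    \<comment> \<open>Convergence at a real point of larger modulus implies convergence at
      \<open>z\<close>.\<close>
    then obtain y where y: "norm z < y" "y < r" using dense by blast
    then have "0 < y" using norm_ge_zero[of z] by linarith
    with y have "summable (\<lambda>m. a m * y ^ m)" using sums_summable[OF s[of y]] by simp
    from summable_of_real[OF this] have "summable (\<lambda>m. of_real (a m) * (of_real y :: complex) ^ m)" by simp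
    then have "summable (\<lambda>m. of_real (a m) * z ^ m)"
      by (rule powser_inside) (use y \<open>0 < y\<close> in auto)
    then show ?thesis by (simp add: H_def summable_sums)
  qed
  show ?thesis
  proof (rule hol_germI[OF r])
    show "H holomorphic_on ball 0 r" by (rule power_series_holomorphic) (rule Hs)
    show "H (of_real t) = of_real (g t \<bullet> b)" if "\<bar>t\<bar> < r" for t
    proof -
      have "(\<lambda>m. of_real (a m * t ^ m)) sums (of_real (g t \<bullet> b) :: complex)"
        using s[OF that] by (rule sums_of_real)
      then show ?thesis using Hs[of "of_real t"] that by (auto dest: sums_unique2)
    qed
  qed
qed

subsection \<open>Surfaces bent along a half-space\<close>

lemma real_analytic_at_power:
  fixes x b :: "'a::euclidean_space" and w :: "'b::real_normed_vector"
  assumes b: "b \<in> Basis"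
  shows "real_analytic_at (\<lambda>y. ((y - x) \<bullet> b) ^ m *\<^sub>R w) x"
proof -
  \<comment> \<open>The multi-index of the single non-zero term of the power series.\<close>
  define \<alpha>0 where "\<alpha>0 = (\<lambda>c\<in>Basis. if c = b then m else 0)"
  define c where "c = (\<lambda>\<alpha>. if \<alpha> = \<alpha>0 then w else 0)"
  have "((\<lambda>\<alpha>. (\<Prod>b\<in>Basis. ((y - x) \<bullet> b) ^ \<alpha> b) *\<^sub>R c \<alpha>) has_sum ((y - x) \<bullet> b) ^ m *\<^sub>R w)
      (Basis \<rightarrow>\<^sub>E (UNIV :: nat set))" (is "(?f has_sum _) _") for y
  proof -
    have "(\<Prod>b'\<in>Basis. ((y - x) \<bullet> b') ^ \<alpha>0 b') = (\<Prod>b'\<in>Basis. if b' = b then ((y - x) \<bullet> b) ^ m else 1)"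
      by (rule prod.cong) (auto simp: \<alpha>0_def)
    also have "\<dots> = ((y - x) \<bullet> b) ^ m" using b by (simp add: prod.delta)
    finally have "?f \<alpha>0 = ((y - x) \<bullet> b) ^ m *\<^sub>R w" by (simp add: c_def)
    moreover have "(?f has_sum sum ?f {\<alpha>0}) {\<alpha>0}" by (rule has_sum_finite) simp
    moreover have "(?f has_sum ?f \<alpha>0) {\<alpha>0} \<longleftrightarrow> (?f has_sum ?f \<alpha>0) (Basis \<rightarrow>\<^sub>E (UNIV :: nat set))"
      by (rule has_sum_cong_neutral) (auto simp: c_def \<alpha>0_def)
    ultimately show ?thesis by simp
  qed
  then show ?thesis
    unfolding real_analytic_at_def by (intro exI[of _ 1] conjI exI[of _ c]) auto
qed

lemma real_analytic_at_const: "real_analytic_at (\<lambda>y::'a::euclidean_space. w) x"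
  using real_analytic_at_power[of "SOME b. b \<in> Basis" x 0 w] some_in_eq by force

lemma real_analytic_at_add:
  assumes "real_analytic_at f x" "real_analytic_at g x"
  shows "real_analytic_at (\<lambda>y. f y + g y) x"
proof -
  from assms(1)[unfolded real_analytic_at_def] obtain r c where
    r: "r > 0" "\<forall>y\<in>ball x r. ((\<lambda>\<alpha>. (\<Prod>b\<in>Basis. ((y - x) \<bullet> b) ^ \<alpha> b) *\<^sub>R c \<alpha>) has_sum f y) (Basis \<rightarrow>\<^sub>E (UNIV :: nat set))"
    by (elim exE conjE) (rule that)
  from assms(2)[unfolded real_analytic_at_def] obtain s d where
    s: "s > 0" "\<forall>y\<in>ball x s. ((\<lambda>\<alpha>. (\<Prod>b\<in>Basis. ((y - x) \<bullet> b) ^ \<alpha> b) *\<^sub>R d \<alpha>) has_sum g y) (Basis \<rightarrow>\<^sub>E (UNIV :: nat set))"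
    by (elim exE conjE) (rule that)
  show ?thesis
    unfolding real_analytic_at_def
  proof (intro exI[of _ "min r s"] conjI exI[of _ "\<lambda>\<alpha>. c \<alpha> + d \<alpha>"] ballI)
    fix y assume "y \<in> ball x (min r s)"
    then show "((\<lambda>\<alpha>. (\<Prod>b\<in>Basis. ((y - x) \<bullet> b) ^ \<alpha> b) *\<^sub>R (c \<alpha> + d \<alpha>)) has_sum (f y + g y)) (Basis \<rightarrow>\<^sub>E UNIV)"
      unfolding scaleR_right_distrib by (intro has_sum_add r(2)[rule_format] s(2)[rule_format]) auto
  qed (use r s in auto)
qed

lemma real_analytic_at_sum:
  assumes "\<And>i. i \<in> I \<Longrightarrow> real_analytic_at (f i) (x::'a::euclidean_space)"
  shows "real_analytic_at (\<lambda>y. \<Sum>i\<in>I. f i y) x"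
  using assms by (induction I rule: infinite_finite_induct) (auto intro: real_analytic_at_const real_analytic_at_add)

lemma real_analytic_at_linear:
  assumes "linear f"
  shows "real_analytic_at f (x::'a::euclidean_space)"
proof -
  have eq: "f = (\<lambda>y. f x + (\<Sum>b\<in>Basis. ((y - x) \<bullet> b) ^ 1 *\<^sub>R f b))"
  proof
    fix y
    have "f y = f x + f (y - x)" using linear_add[OF assms, of x "y - x"] by simp
    also have "f (y - x) = f (\<Sum>b\<in>Basis. ((y - x) \<bullet> b) *\<^sub>R b)" by (simp only: euclidean_representation)
    also have "\<dots> = (\<Sum>b\<in>Basis. ((y - x) \<bullet> b) *\<^sub>R f b)"
      by (simp add: linear_sum[OF assms] linear_scale[OF assms])
    finally show "f y = f x + (\<Sum>b\<in>Basis. ((y - x) \<bullet> b) ^ 1 *\<^sub>R f b)" by simp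
  qed
  show ?thesis
    by (subst eq) (intro real_analytic_at_add real_analytic_at_const real_analytic_at_sum real_analytic_at_power)
qed

lemma real_analytic_at_poly:
  fixes x b :: "'a::euclidean_space"
  assumes "b \<in> Basis"
  shows "real_analytic_at (\<lambda>y. poly R (y \<bullet> b) *\<^sub>R w) x"
proof -
  let ?R = "pcompose R [:x \<bullet> b, 1:]"
  have eq: "(\<lambda>y. poly R (y \<bullet> b) *\<^sub>R w) = (\<lambda>y. \<Sum>i\<le>degree ?R. ((y - x) \<bullet> b) ^ i *\<^sub>R (coeff ?R i *\<^sub>R w))"
  proof
    fix y
    have "poly R (y \<bullet> b) = poly ?R ((y - x) \<bullet> b)" by (simp add: poly_pcompose inner_diff_left)
    also have "\<dots> = (\<Sum>i\<le>degree ?R. coeff ?R i * ((y - x) \<bullet> b) ^ i)" by (rule poly_altdef)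
    finally show "poly R (y \<bullet> b) *\<^sub>R w = (\<Sum>i\<le>degree ?R. ((y - x) \<bullet> b) ^ i *\<^sub>R (coeff ?R i *\<^sub>R w))"
      by (simp add: scaleR_sum_left mult.commute)
  qed
  show ?thesis
    by (subst eq) (intro real_analytic_at_sum real_analytic_at_power assms)
qed

text \<open>An isometry onto the hyperplane orthogonal to \<open>n\<close>, composed with a rotation
  of the parameter space that makes \<open>u\<close> a coordinate direction. The coordinate
  \<open>k\<close> then plays the role of \<open>x\<close>, and the profile of a surface depends on
  it alone.\<close>

lemma hyperplane_coordinates:
  fixes u n :: "real ^ 'd::finite"
  assumes u: "norm u = 1" and n: "norm n = 1" and un: "n \<bullet> u = 0" and card: "CARD('k::finite) + 1 = CARD('d)"
  obtains L :: "real ^ 'k \<Rightarrow> real ^ 'd" and M k where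
    "linear L" "linear M" "\<And>x. M (L x) = x" "\<And>x. n \<bullet> L x = 0" "\<And>y. n \<bullet> y = 0 \<Longrightarrow> L (M y) = y"
    "\<And>x. norm (L x) = norm x" "\<And>x. u \<bullet> L x = x $ k"
proof -
  let ?T = "{x. n \<bullet> x = 0}"
  have "n \<noteq> 0" using n by auto
  then have "dim (UNIV :: (real ^ 'k) set) = dim ?T"
    using card by (simp add: dim_hyperplane)
  then obtain L0 :: "real ^ 'k \<Rightarrow> real ^ 'd" and M0 where
    L0: "linear L0" "linear M0" "L0 ` UNIV = ?T" "M0 ` ?T = UNIV"
    "\<And>x. x \<in> UNIV \<Longrightarrow> norm (L0 x) = norm x" "\<And>x. x \<in> ?T \<Longrightarrow> norm (M0 x) = norm x"
    "\<And>x. x \<in> UNIV \<Longrightarrow> M0 (L0 x) = x" "\<And>x. x \<in> ?T \<Longrightarrow> L0 (M0 x) = x"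
    by (rule isometries_subspaces[OF subspace_UNIV subspace_hyperplane]) (rule that)
  define k where "k = (SOME k::'k. True)"
  have ax: "norm (axis k 1 :: real ^ 'k) = 1" by simp
  have M0u: "norm (M0 u) = 1" using L0(6)[of u] u un by simp
  obtain T :: "real ^ 'k \<Rightarrow> real ^ 'k" where T: "orthogonal_transformation T" "T (axis k 1) = M0 u"
    by (rule orthogonal_transformation_exists_1[OF ax M0u]) (rule that, assumption, assumption)
  define T' where "T' = inv T"
  have T': "linear T'" "\<And>x. T (T' x) = x" "\<And>x. T' (T x) = x"
    using orthogonal_transformation_inv[OF T(1)] orthogonal_transformation_bij[OF T(1)]
    by (auto simp: T'_def orthogonal_transformation_def bij_is_inj bij_is_surj surj_f_inv_f)
  define L M where "L = L0 \<circ> T" and "M = T' \<circ> M0"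
  have lin: "linear L" "linear M"
    using L0 T T' by (auto simp: L_def M_def orthogonal_transformation_def intro: linear_compose)
  have nrm: "norm (L x) = norm x" for x
    using L0(5) T(1) by (simp add: L_def orthogonal_transformation)
  have "L (axis k 1) = u" using L0(8)[of u] un T(2) by (simp add: L_def)
  then have "u \<bullet> L x = L (axis k 1) \<bullet> L x" for x by simp
  \<comment> \<open>By polarisation, preserving norms implies preserving inner products.\<close>
  also have "L (axis k 1) \<bullet> L x = axis k 1 \<bullet> x" for x
    by (simp add: dot_norm nrm flip: linear_add[OF lin(1)])
  also have "axis k 1 \<bullet> x = x $ k" for x :: "real ^ 'k"
    by (simp add: inner_axis inner_commute)
  finally have uL: "u \<bullet> L x = x $ k" for x .
  show ?thesis
  proof (rule that[OF lin _ _ _ nrm uL])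
    show "M (L x) = x" for x using L0(7) T' by (simp add: L_def M_def)
    show "n \<bullet> L x = 0" for x using L0(3) by (auto simp: L_def)
    show "L (M y) = y" if "n \<bullet> y = 0" for y using L0(8)[of y] that T' by (simp add: L_def M_def)
  qed
qed

section \<open>Regularity of graphs that are polynomial on one half-space and flat on the
  other\<close>

lemma max_square_derivative:
  "((\<lambda>x. (max 0 x)\<^sup>2) has_real_derivative 2 * max 0 x) (at x)"
proof -
  consider "x > 0" | "x < 0" | "x = 0" by linarith
  then show ?thesis
  proof cases
    case 1
    have "((\<lambda>x. x\<^sup>2) has_real_derivative 2 * max 0 x) (at x)"
      using 1 by (auto intro!: derivative_eq_intros)
    then show ?thesis
      by (rule has_field_derivative_transform_within_open[where S = "{0<..}"]) (use 1 in auto)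
  next
    case 2
    have "((\<lambda>x. 0) has_real_derivative 2 * max 0 x) (at x)"
      using 2 by (auto intro!: derivative_eq_intros)
    then show ?thesis
      by (rule has_field_derivative_transform_within_open[where S = "{..<0}"]) (use 2 in auto)
  next
    case 3
    have "((\<lambda>h::real. max 0 h) \<longlongrightarrow> 0) (at 0)"
      using tendsto_max[OF tendsto_const tendsto_ident_at, of "0::real" 0 UNIV] by simp
    then have "((\<lambda>h::real. ((max 0 h)\<^sup>2 - (max 0 0)\<^sup>2) / (h - 0)) \<longlongrightarrow> 0) (at 0)"
    proof (rule Lim_transform_eventually)
      show "\<forall>\<^sub>F h::real in at 0. max 0 h = ((max 0 h)\<^sup>2 - (max 0 0)\<^sup>2) / (h - 0)"
        unfolding eventually_at_filter
        by (rule always_eventually) (auto simp: max_def power2_eq_square)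
    qed
    then show ?thesis using 3 by (simp add: has_field_derivative_iff)
  qed
qed

text \<open>The half-parabola \<open>(max 0 x)\<^sup>2\<close> glues a polynomial to \<open>0\<close> in a continuously differentiable way.\<close>

lemma graph_C1:
  fixes L :: "real ^ 'k::finite \<Rightarrow> real ^ 'd::finite" and P :: "real poly"
  defines "Q \<equiv> \<lambda>x. (max 0 x)\<^sup>2 * poly P x"
  assumes L: "linear L" "\<And>x. n \<bullet> L x = 0" "\<And>x. norm (L x) = norm x" and n: "norm n = 1" and e: "\<epsilon> > 0"
    and W: "open W" "x \<in> W" "\<And>y. y \<in> W \<Longrightarrow> F y = p + \<epsilon> *\<^sub>R L y + Q (\<epsilon> * y $ k) *\<^sub>R n"
  shows "C1_immersion_at F x"
proof -
  define Q' where "Q' x = 2 * max 0 x * poly P x + (max 0 x)\<^sup>2 * poly (pderiv P) x" for x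
  have Q': "(Q has_real_derivative Q' x) (at x)" for x
    unfolding Q_def Q'_def
    by (rule derivative_eq_intros max_square_derivative poly_DERIV refl)+ (simp add: algebra_simps)
  have bl: "bounded_linear L" using L(1) by (simp add: linear_conv_bounded_linear)
  define B1 where "B1 = Blinfun (\<lambda>h. \<epsilon> *\<^sub>R L h)"
  define B2 where "B2 = Blinfun (\<lambda>h::real ^ 'k. (\<epsilon> * h $ k) *\<^sub>R n)"
  have B1: "blinfun_apply B1 h = \<epsilon> *\<^sub>R L h" for h
    unfolding B1_def by (subst bounded_linear_Blinfun_apply) (auto intro: bounded_linear_intros bl)
  have "bounded_linear (\<lambda>h::real ^ 'k. (\<epsilon> * h $ k) *\<^sub>R n)"
    by (intro bounded_linear_scaleR_const bounded_linear_const_mult bounded_linear_vec_nth)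
  then have B2: "blinfun_apply B2 h = (\<epsilon> * h $ k) *\<^sub>R n" for h
    unfolding B2_def by (subst bounded_linear_Blinfun_apply) auto
  define f' where "f' y = B1 + Q' (\<epsilon> * y $ k) *\<^sub>R B2" for y :: "real ^ 'k"
  have f': "blinfun_apply (f' y) h = \<epsilon> *\<^sub>R L h + (Q' (\<epsilon> * y $ k) * (\<epsilon> * h $ k)) *\<^sub>R n" for y h
    by (simp add: f'_def B1 B2 blinfun.add_left blinfun.scaleR_left)
  have der: "(F has_derivative blinfun_apply (f' y)) (at y)" if "y \<in> W" for y
  proof (rule has_derivative_transform_within_open[OF _ W(1) that])
    have c: "((\<lambda>y. \<epsilon> * y $ k) has_derivative (\<lambda>h. \<epsilon> * h $ k)) (at y)"
      by (intro bounded_linear_imp_has_derivative bounded_linear_const_mult bounded_linear_vec_nth)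
    have q: "((\<lambda>y. Q (\<epsilon> * y $ k)) has_derivative (\<lambda>h. (\<epsilon> * h $ k) * Q' (\<epsilon> * y $ k))) (at y)"
      by (rule DERIV_compose_FDERIV[OF Q' c])
    have l: "(L has_derivative L) (at y)" by (rule bounded_linear_imp_has_derivative[OF bl])
    have "((\<lambda>y. p + \<epsilon> *\<^sub>R L y + Q (\<epsilon> * y $ k) *\<^sub>R n) has_derivative
        (\<lambda>h. 0 + \<epsilon> *\<^sub>R L h + ((\<epsilon> * h $ k) * Q' (\<epsilon> * y $ k)) *\<^sub>R n)) (at y)"
      by (intro has_derivative_add has_derivative_const has_derivative_scaleR_right l has_derivative_scaleR_left q)
    moreover have "(\<lambda>h. 0 + \<epsilon> *\<^sub>R L h + ((\<epsilon> * h $ k) * Q' (\<epsilon> * y $ k)) *\<^sub>R n) = blinfun_apply (f' y)"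
      by (auto simp: f' mult.commute)
    ultimately show "((\<lambda>y. p + \<epsilon> *\<^sub>R L y + Q (\<epsilon> * y $ k) *\<^sub>R n) has_derivative blinfun_apply (f' y)) (at y)"
      by simp
  qed (simp add: W(3))
  have cont: "continuous_on W f'"
    unfolding f'_def Q'_def by (intro continuous_intros)
  \<comment> \<open>The range of \<open>L\<close> is orthogonal to \<open>n\<close>. Pairing with
    \<open>n\<close> therefore isolates the bending term; once this is zero, \<open>L h = 0\<close>,
    and \<open>L\<close> is isometric.\<close>
  have "h = 0" if "blinfun_apply (f' x) h = 0" for h
  proof -
    let ?c = "Q' (\<epsilon> * x $ k) * (\<epsilon> * h $ k)"
    have z: "\<epsilon> *\<^sub>R L h + ?c *\<^sub>R n = 0" using that by (simp add: f')
    have "n \<bullet> (\<epsilon> *\<^sub>R L h + ?c *\<^sub>R n) = ?c"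
      using n by (simp add: inner_add_right L(2) flip: power2_norm_eq_inner)
    then have c0: "?c = 0" by (simp only: z inner_zero_right)
    then have "L h = 0" using z e unfolding c0 by simp
    then show "h = 0" using L(3)[of h] by simp
  qed
  moreover have "linear (blinfun_apply (f' x))"
    by (simp add: blinfun.bounded_linear_right bounded_linear.linear)
  ultimately have "inj (blinfun_apply (f' x))" using linear_injective_0 by blast
  with der cont W(1,2) show ?thesis unfolding C1_immersion_at_def by blast
qed

lemma graph_semianalytic:
  fixes L :: "real ^ 'k::finite \<Rightarrow> real ^ 'd::finite" and P :: "real poly"
  defines "Q \<equiv> \<lambda>x. (max 0 x)\<^sup>2 * poly P x"
  assumes L: "linear L" and e: "\<epsilon> > 0"
    and W: "open W" "x \<in> W" "\<And>y. y \<in> W \<Longrightarrow> F y = p + \<epsilon> *\<^sub>R L y + Q (\<epsilon> * y $ k) *\<^sub>R n"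
  shows "semianalytic_at F x"
proof -
  let ?h = "\<lambda>y::real ^ 'k. y $ k"
  have lin: "linear (\<lambda>y. \<epsilon> *\<^sub>R L y)" using L by (rule linear_compose_scale_right)
  have h: "real_analytic_on ?h W"
    unfolding real_analytic_on_def
    by (intro ballI real_analytic_at_linear bounded_linear.linear[OF bounded_linear_vec_nth])
  have "\<exists>g. real_analytic_on g W \<and> (\<forall>y\<in>W. sgn (y $ k) = s \<longrightarrow> F y = g y)" for s
  proof (cases "s = 1")
    case True
    \<comment> \<open>The profile \<open>x^2 * P x\<close> on the positive side, evaluated at the
      scaled coordinate.\<close>
    define R where "R = pcompose ([:0, 1:]\<^sup>2 * P) [:0, \<epsilon>:]"
    define g where "g y = p + \<epsilon> *\<^sub>R L y + poly R (y \<bullet> axis k 1) *\<^sub>R n" for y :: "real ^ 'k"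
    have "real_analytic_on g W"
      unfolding real_analytic_on_def g_def
      by (intro ballI real_analytic_at_add real_analytic_at_const real_analytic_at_poly
          real_analytic_at_linear[OF lin]) (auto simp: axis_in_Basis_iff)
    moreover have "F y = g y" if "y \<in> W" "sgn (y $ k) = s" for y
    proof -
      have "y $ k > 0" using that(2) True by (simp add: sgn_1_pos)
      then show ?thesis using W(3)[OF that(1)] e
        by (simp add: g_def Q_def R_def poly_pcompose inner_axis mult.commute)
    qed
    ultimately show ?thesis by blast
  next
    \<comment> \<open>The flat piece serves the signs 0 and -1; for values that are not signs
      nothing has to be matched.\<close>
    case False
    define g where "g y = p + \<epsilon> *\<^sub>R L y" for y :: "real ^ 'k"
    have "real_analytic_on g W"
      unfolding real_analytic_on_def g_def
      by (intro ballI real_analytic_at_add real_analytic_at_const real_analytic_at_linear[OF lin])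
    moreover have "F y = g y" if "y \<in> W" "sgn (y $ k) = s" for y
    proof -
      have "\<not> y $ k > 0" using that(2) False by (auto simp: sgn_1_pos)
      then show ?thesis using W(3)[OF that(1)] e
        by (simp add: g_def Q_def max_absorb1 mult_nonneg_nonpos)
    qed
    ultimately show ?thesis by blast
  qed
  then show ?thesis
    unfolding semianalytic_at_def using W(1,2) h
    by (intro exI[of _ W] exI[of _ "{?h}"]) auto
qed

section \<open>The graph as an oriented surface in the manifold\<close>

lemma norm_cube:
  assumes "x \<in> (cube :: (real ^ 'k::finite) set)"
  shows "norm x \<le> CARD('k) / 2"
proof -
  have "norm x \<le> (\<Sum>i\<in>UNIV. \<bar>x $ i\<bar>)" by (rule norm_le_l1_cart)
  also have "\<dots> \<le> (\<Sum>i\<in>(UNIV::'k set). 1 / 2)"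
  proof (rule sum_mono)
    fix i
    have "- 1 / 2 < x $ i \<and> x $ i < 1 / 2" using assms by (simp add: cube_def)
    then show "\<bar>x $ i\<bar> \<le> 1 / 2" by linarith
  qed
  finally show ?thesis by simp
qed

lemma open_cube: "open (cube :: (real ^ 'k::finite) set)"
proof -
  have "cube = (\<Inter>i. {x::real ^ 'k. - 1 / 2 < x $ i} \<inter> {x. x $ i < 1 / 2})"
    by (auto simp: cube_def)
  moreover have "open (\<Inter>i\<in>(UNIV::'k set). {x::real ^ 'k. - 1 / 2 < x $ i} \<inter> {x. x $ i < 1 / 2})"
    by (intro open_INT open_Int open_Collect_less continuous_intros ballI) auto
  ultimately show ?thesis by metis
qed

text \<open>The surface is the chart preimage of a piece of the graph with profile \<open>Q\<close>
  over the hyperplane orthogonal to \<open>n\<close>, and its sides are the two strict inequalities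
  inside a small ball. A curve tending to \<open>v\<close> eventually enters this ball, so being
  above or below becomes a bare inequality between chart coordinates.\<close>

lemma surface_exists:
  fixes \<A> :: "('a::{t2_space,second_countable_topology}, 'd::finite) chart set"
    and u n :: "real ^ 'd" and P :: "real poly"
  defines "Q \<equiv> \<lambda>x. (max 0 x)\<^sup>2 * poly P x"
  assumes atlas: "analytic_atlas \<A>" and chart: "(U, \<phi>) \<in> \<A>" "v \<in> U"
    and u: "norm u = 1" and n: "norm n = 1" and nu: "n \<bullet> u = 0" and card: "CARD('k::finite) + 1 = CARD('d)"
  obtains S :: "('a, 'k::finite) surface" where "surface_through \<A> v S"
    "\<And>c. (c \<longlongrightarrow> v) (at_right (0::real)) \<Longrightarrow>
      (\<forall>\<^sub>F t in at_right 0. c t \<in> above S) \<longleftrightarrow>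
      (\<forall>\<^sub>F t in at_right 0. n \<bullet> (\<phi> (c t) - \<phi> v) > Q (u \<bullet> (\<phi> (c t) - \<phi> v)))"
    "\<And>c. (c \<longlongrightarrow> v) (at_right (0::real)) \<Longrightarrow>
      (\<forall>\<^sub>F t in at_right 0. c t \<in> below S) \<longleftrightarrow>
      (\<forall>\<^sub>F t in at_right 0. n \<bullet> (\<phi> (c t) - \<phi> v) < Q (u \<bullet> (\<phi> (c t) - \<phi> v)))"
proof -
  define \<psi> where "\<psi> = inv_into U \<phi>"
  define p where "p = \<phi> v"
  have oU: "open U" and oV: "open (\<phi> ` U)" and hom: "homeomorphism U (\<phi> ` U) \<phi> \<psi>"
    using atlas chart(1) unfolding analytic_atlas_def \<psi>_def by auto
  have c\<phi>: "continuous_on U \<phi>" and c\<psi>: "continuous_on (\<phi> ` U) \<psi>"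
    and \<psi>\<phi>: "\<And>x. x \<in> U \<Longrightarrow> \<psi> (\<phi> x) = x" and \<phi>\<psi>: "\<And>y. y \<in> \<phi> ` U \<Longrightarrow> \<phi> (\<psi> y) = y"
    and \<psi>U: "\<And>y. y \<in> \<phi> ` U \<Longrightarrow> \<psi> y \<in> U"
    using hom unfolding homeomorphism_def by auto
  obtain L :: "real ^ 'k \<Rightarrow> real ^ 'd" and M k where
    L: "linear L" "linear M" "\<And>x. M (L x) = x" "\<And>x. n \<bullet> L x = 0" "\<And>y. n \<bullet> y = 0 \<Longrightarrow> L (M y) = y"
    "\<And>x. norm (L x) = norm x" "\<And>x. u \<bullet> L x = x $ k"
    by (rule hyperplane_coordinates[OF u n nu card]) (rule that)
  have nn: "n \<bullet> n = 1" using n by (simp flip: power2_norm_eq_inner)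
  have Q0: "Q 0 = 0" by (simp add: Q_def)
  have cQ': "continuous_on X (\<lambda>y. Q (f y))" if "continuous_on X f" for X and f :: "'z::topological_space \<Rightarrow> real"
    using that unfolding Q_def by (intro continuous_intros)
  have cL: "continuous_on X L" for X using L(1) by (simp add: linear_continuous_on linear_conv_bounded_linear)
  have cM: "continuous_on X M" for X using L(2) by (simp add: linear_continuous_on linear_conv_bounded_linear)
  obtain r where r: "r > 0" "ball p r \<subseteq> \<phi> ` U"
    using oV chart(2) unfolding p_def by (meson imageI openE)
  define G1 where "G1 y = p + L y + Q (y $ k) *\<^sub>R n" for y
  have "continuous_on UNIV G1" unfolding G1_def by (intro continuous_intros cL cQ')
  then have "isCont G1 0" by (simp add: continuous_on_eq_continuous_at)
  moreover have G10: "G1 0 = p" using linear_0[OF L(1)] by (simp add: G1_def Q0)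
  ultimately obtain \<delta> where \<delta>: "\<delta> > 0" "\<And>y. dist y 0 < \<delta> \<Longrightarrow> dist (G1 y) p < r"
    using r(1) unfolding continuous_at_eps_delta by metis
  \<comment> \<open>The scaled cube then has norm at most \<open>\<delta> / 2\<close>, so the whole
    face stays inside the chart.\<close>
  define \<epsilon> where "\<epsilon> = \<delta> / CARD('k)"
  have \<epsilon>: "\<epsilon> > 0" using \<delta>(1) by (simp add: \<epsilon>_def)
  define G where "G \<xi> = p + \<epsilon> *\<^sub>R L \<xi> + Q (\<epsilon> * \<xi> $ k) *\<^sub>R n" for \<xi>
  have GG1: "G \<xi> = G1 (\<epsilon> *\<^sub>R \<xi>)" for \<xi> by (simp add: G_def G1_def linear_scale[OF L(1)])
  have Gball: "G \<xi> \<in> ball p r" if "\<xi> \<in> cube" for \<xi>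
  proof -
    have "norm (\<epsilon> *\<^sub>R \<xi>) \<le> \<epsilon> * (CARD('k) / 2)"
      using norm_cube[OF that] \<epsilon> by simp
    also have "\<dots> < \<delta>" using \<delta>(1) by (simp add: \<epsilon>_def)
    finally show ?thesis using \<delta>(2)[of "\<epsilon> *\<^sub>R \<xi>"] by (simp add: GG1 dist_commute)
  qed
  have GV: "G \<xi> \<in> \<phi> ` U" if "\<xi> \<in> cube" for \<xi> using Gball[OF that] r(2) by blast
  have nG: "n \<bullet> (G \<xi> - p) = Q (\<epsilon> * \<xi> $ k)" and uG: "u \<bullet> (G \<xi> - p) = \<epsilon> * \<xi> $ k" for \<xi>
    using nu by (simp_all add: G_def inner_add_right L(4,7) nn inner_commute[of u n])
  define F where "F \<xi> = \<psi> (G \<xi>)" for \<xi>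
  have \<phi>F: "\<phi> (F \<xi>) = G \<xi>" and FU: "F \<xi> \<in> U" if "\<xi> \<in> cube" for \<xi>
    using GV[OF that] \<phi>\<psi> \<psi>U by (simp_all add: F_def)
  have F0: "F 0 = v" using \<psi>\<phi>[OF chart(2)] by (simp add: F_def GG1 G10 p_def)
  \<comment> \<open>The projection along \<open>n\<close> forgets the bending. Hence
    \<open>K\<close>, which is defined and continuous on all of \<open>U\<close>, recovers the
    parameter from a point of the face and gives the continuous inverse.\<close>
  define z where "z y = y - (n \<bullet> y) *\<^sub>R n" for y :: "real ^ 'd"
  have nz: "n \<bullet> z y = 0" for y by (simp add: z_def inner_diff_right nn)
  define K where "K a = M (z (\<phi> a - p)) /\<^sub>R \<epsilon>" for a
  have KF: "K (F \<xi>) = \<xi>" if "\<xi> \<in> cube" for \<xi>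
  proof -
    have "z (G \<xi> - p) = \<epsilon> *\<^sub>R L \<xi>" unfolding z_def nG by (simp add: G_def)
    then show ?thesis
      using \<phi>F[OF that] \<epsilon> by (simp add: K_def linear_scale[OF L(2)] L(3))
  qed
  have cF: "continuous_on cube F"
    unfolding F_def
  proof (rule continuous_on_compose2[OF c\<psi>])
    show "continuous_on cube G" unfolding G_def by (intro continuous_intros cL cQ')
  qed (use GV in auto)
  have cK: "continuous_on U K"
    unfolding K_def z_def
    by (intro continuous_intros continuous_on_compose2[OF cM] c\<phi>) auto
  have injF: "inj_on F cube" by (rule inj_on_inverseI[of _ K]) (rule KF)
  have homF: "homeomorphism cube (F ` cube) F (inv_into cube F)"
  proof (rule homeomorphismI)
    have "continuous_on (F ` cube) K" by (rule continuous_on_subset[OF cK]) (use FU in auto)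
    moreover have "inv_into cube F a = K a" if "a \<in> F ` cube" for a
      using that KF injF by auto
    ultimately show "continuous_on (F ` cube) (inv_into cube F)"
      by (subst continuous_on_cong[OF refl, of _ _ K]) auto
  qed (use cF injF in \<open>auto simp: inv_into_into f_inv_into_f\<close>)
  have semi: "semianalytic_at (\<phi> \<circ> F) \<xi>" if "\<xi> \<in> cube" for \<xi>
    by (rule graph_semianalytic[OF L(1) \<epsilon> open_cube that, where P = P and p = p and n = n and k = k])
       (simp add: \<phi>F G_def Q_def)
  have imm: "C1_immersion_at (\<phi> \<circ> F) \<xi>" if "\<xi> \<in> cube" for \<xi>
    by (rule graph_C1[OF L(1,4,6) n \<epsilon> open_cube that, where P = P and p = p and k = k])
       (simp add: \<phi>F G_def Q_def)
  have emb: "embedded_face \<A> F"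
    unfolding embedded_face_def
  proof (intro conjI ballI homF bexI[of _ "(U, \<phi>)"] chart(1))
    show "case (U, \<phi>) of (U, \<phi>) \<Rightarrow> F \<xi> \<in> U \<and> semianalytic_at (\<phi> \<circ> F) \<xi> \<and> C1_immersion_at (\<phi> \<circ> F) \<xi>"
      if "\<xi> \<in> cube" for \<xi>
      using semi[OF that] imm[OF that] FU[OF that] by simp
  qed
  \<comment> \<open>\<open>\<epsilon> / 4\<close> guarantees that a point of the graph in this ball
    comes from the cube: the projection at most doubles norms, so the parameter has norm below 1/2.
    Thus nothing is missing between the two sides near \<open>v\<close>.\<close>
  define \<rho> where "\<rho> = min r (\<epsilon> / 4)"
  have \<rho>: "\<rho> > 0" using r(1) \<epsilon> by (simp add: \<rho>_def)
  define N where "N = {a \<in> U. \<phi> a \<in> ball p \<rho>}"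
  define A where "A = {a \<in> U. \<phi> a \<in> {y \<in> ball p \<rho>. n \<bullet> (y - p) > Q (u \<bullet> (y - p))}}"
  define B where "B = {a \<in> U. \<phi> a \<in> {y \<in> ball p \<rho>. n \<bullet> (y - p) < Q (u \<bullet> (y - p))}}"
  have pre: "open {a \<in> U. \<phi> a \<in> X}" if "open X" for X
    using continuous_open_preimage[OF c\<phi> oU that] by (simp add: vimage_def Int_def)
  have oN: "open N" unfolding N_def by (rule pre) simp
  have "{y \<in> ball p \<rho>. n \<bullet> (y - p) > Q (u \<bullet> (y - p))} = ball p \<rho> \<inter> {y. n \<bullet> (y - p) > Q (u \<bullet> (y - p))}" by auto
  also have "open \<dots>" by (intro open_Int open_ball open_Collect_less continuous_intros cQ')
  finally have oA: "open A" unfolding A_def by (rule pre)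
  have "{y \<in> ball p \<rho>. n \<bullet> (y - p) < Q (u \<bullet> (y - p))} = ball p \<rho> \<inter> {y. n \<bullet> (y - p) < Q (u \<bullet> (y - p))}" by auto
  also have "open \<dots>" by (intro open_Int open_ball open_Collect_less continuous_intros cQ')
  finally have oB: "open B" unfolding B_def by (rule pre)
  have graph: "a \<in> F ` cube" if "a \<in> N" "n \<bullet> (\<phi> a - p) = Q (u \<bullet> (\<phi> a - p))" for a
  proof -
    let ?y = "\<phi> a - p"
    let ?\<xi> = "K a"
    have y: "norm ?y < \<epsilon> / 4" using that(1) by (simp add: N_def \<rho>_def dist_norm norm_minus_commute)
    have \<epsilon>\<xi>: "\<epsilon> *\<^sub>R ?\<xi> = M (z ?y)" using \<epsilon> by (simp add: K_def)
    have "u \<bullet> L (M (z ?y)) = u \<bullet> ?y"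
      using nu by (simp add: L(5)[OF nz]) (simp add: z_def inner_diff_right inner_commute)
    moreover have "\<epsilon> * ?\<xi> $ k = M (z ?y) $ k" by (simp flip: \<epsilon>\<xi>)
    ultimately have k: "\<epsilon> * ?\<xi> $ k = u \<bullet> ?y" by (simp add: L(7))
    have "\<epsilon> *\<^sub>R L ?\<xi> = L (M (z ?y))" by (simp only: \<epsilon>\<xi> flip: linear_scale[OF L(1)])
    then have "\<epsilon> *\<^sub>R L ?\<xi> = z ?y" by (simp only: L(5)[OF nz])
    then have "G ?\<xi> = \<phi> a"
      unfolding G_def k that(2)[symmetric] by (simp add: z_def)
    then have Fa: "F ?\<xi> = a" using \<psi>\<phi> that(1) by (simp add: F_def N_def)
    have "\<epsilon> * norm ?\<xi> = norm (\<epsilon> *\<^sub>R ?\<xi>)" using \<epsilon> by simp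
    also have "\<dots> = norm (L (M (z ?y)))" by (simp only: \<epsilon>\<xi> L(6))
    also have "\<dots> = norm (z ?y)" by (simp only: L(5)[OF nz])
    finally have "\<epsilon> * norm ?\<xi> = norm (z ?y)" .
    also have "\<dots> \<le> norm ?y + norm ((n \<bullet> ?y) *\<^sub>R n)" unfolding z_def by (rule norm_triangle_ineq4)
    also have "\<dots> \<le> 2 * norm ?y" using Cauchy_Schwarz_ineq2[of n ?y] n by simp
    also have "\<dots> < \<epsilon> * (1 / 2)" using y by simp
    finally have "norm ?\<xi> < 1 / 2" using \<epsilon> by simp
    then have "- 1 / 2 < ?\<xi> $ i \<and> ?\<xi> $ i < 1 / 2" for i
      using component_le_norm_cart[of ?\<xi> i] by linarith
    then have "?\<xi> \<in> cube" unfolding cube_def by blast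
    then show ?thesis using Fa by force
  qed
  have vN: "v \<in> N" using chart(2) \<rho> by (simp add: N_def p_def)
  have disj: "(A \<union> B) \<inter> F ` cube = {}"
    using \<phi>F nG uG by (auto simp: A_def B_def)
  have "N \<subseteq> A \<union> B \<union> F ` cube"
  proof
    fix a assume a: "a \<in> N"
    then have "a \<in> A" if "n \<bullet> (\<phi> a - p) > Q (u \<bullet> (\<phi> a - p))" using that by (simp add: A_def N_def)
    moreover from a have "a \<in> B" if "n \<bullet> (\<phi> a - p) < Q (u \<bullet> (\<phi> a - p))" using that by (simp add: B_def N_def)
    ultimately show "a \<in> A \<union> B \<union> F ` cube" using graph[OF a] by fastforce
  qed
  then have int: "v \<in> interior (A \<union> B \<union> F ` cube)" using vN oN by (meson interiorI)
  have inN: "\<forall>\<^sub>F t in at_right 0. c t \<in> N" if "(c \<longlongrightarrow> v) (at_right (0::real))" for c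
    using that oN vN by (rule topological_tendstoD)
  \<comment> \<open>Used with \<open>w\<close> equal to \<open>n\<close> and \<open>- n\<close>.
    Along these rays the \<open>u\<close>-component is 0 and \<open>Q 0 = 0\<close>, so they run
    into \<open>v\<close> inside \<open>A\<close> and \<open>B\<close> respectively.\<close>
  have curve: "((\<lambda>t. \<psi> (p + t *\<^sub>R w)) \<longlongrightarrow> v) (at_right (0::real))" for w
  proof -
    have "isCont \<psi> p" using c\<psi> oV chart(2) by (simp add: continuous_on_eq_continuous_at p_def)
    moreover have "((\<lambda>t. p + t *\<^sub>R w) \<longlongrightarrow> p) (at_right (0::real))"
      by (rule tendsto_eq_intros refl)+ simp
    ultimately have "((\<lambda>t. \<psi> (p + t *\<^sub>R w)) \<longlongrightarrow> \<psi> p) (at_right (0::real))"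
      by (rule isCont_tendsto_compose)
    then show ?thesis using \<psi>\<phi>[OF chart(2)] by (simp add: p_def)
  qed
  have small: "\<forall>\<^sub>F t in at_right (0::real). 0 < t \<and> t < \<rho>"
    using eventually_at_right_less[of "0::real"] eventually_at_right_real[OF \<rho>] by eventually_elim auto
  have ray: "\<psi> (p + t *\<^sub>R w) \<in> U \<and> \<phi> (\<psi> (p + t *\<^sub>R w)) = p + t *\<^sub>R w \<and> p + t *\<^sub>R w \<in> ball p \<rho>"
    if "norm w = 1" "0 < t" "t < \<rho>" for t w
  proof -
    have 1: "p + t *\<^sub>R w \<in> ball p \<rho>" using that by (simp add: dist_norm)
    then have "p + t *\<^sub>R w \<in> \<phi> ` U" using r(2) by (auto simp: \<rho>_def)
    then show ?thesis using \<phi>\<psi> \<psi>U 1 by blast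
  qed
  have "\<forall>\<^sub>F t in at_right (0::real). \<psi> (p + t *\<^sub>R n) \<in> closure A"
    using small
  proof eventually_elim
    case (elim t)
    then have "\<psi> (p + t *\<^sub>R n) \<in> A"
      using ray[of n t] n nu Q0 by (simp add: A_def nn inner_commute[of u n])
    then show ?case using closure_subset by blast
  qed
  then have clA: "v \<in> closure A" by (rule Lim_in_closed_set[OF closed_closure _ _ curve]) simp
  have "\<forall>\<^sub>F t in at_right (0::real). \<psi> (p + t *\<^sub>R (- n)) \<in> closure B"
    using small
  proof eventually_elim
    case (elim t)
    then have "\<psi> (p + t *\<^sub>R (- n)) \<in> B"
      using ray[of "- n" t] n nu Q0 by (simp add: B_def nn inner_commute[of u n])
    then show ?case using closure_subset by blast
  qed
  then have clB: "v \<in> closure B" by (rule Lim_in_closed_set[OF closed_closure _ _ curve]) simp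
  define S :: "('a, 'k) surface" where "S = \<lparr>face = F, above = A, below = B\<rparr>"
  show ?thesis
  proof (rule that[of S])
    show "surface_through \<A> v S"
      unfolding surface_through_def S_def
      using emb F0 oA oB disj int clA clB by (auto simp: A_def B_def)
    show "(\<forall>\<^sub>F t in at_right 0. c t \<in> above S) \<longleftrightarrow>
      (\<forall>\<^sub>F t in at_right 0. n \<bullet> (\<phi> (c t) - \<phi> v) > Q (u \<bullet> (\<phi> (c t) - \<phi> v)))"
      if "(c \<longlongrightarrow> v) (at_right (0::real))" for c
      by (rule eventually_subst, rule eventually_mono[OF inN[OF that]]) (simp add: S_def A_def N_def p_def)
    show "(\<forall>\<^sub>F t in at_right 0. c t \<in> below S) \<longleftrightarrow>
      (\<forall>\<^sub>F t in at_right 0. n \<bullet> (\<phi> (c t) - \<phi> v) < Q (u \<bullet> (\<phi> (c t) - \<phi> v)))"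
      if "(c \<longlongrightarrow> v) (at_right (0::real))" for c
      by (rule eventually_subst, rule eventually_mono[OF inN[OF that]]) (simp add: S_def B_def N_def p_def)
  qed
qed

subsection \<open>Curves with a common tangent\<close>

text \<open>The classical fact that a real vector space is not a finite union of proper subspaces;
  it provides generic normals.\<close>

lemma avoid_subspaces:
  fixes B :: "'i \<Rightarrow> 'a::real_vector set"
  assumes "finite I" "subspace V" "\<And>i. i \<in> I \<Longrightarrow> subspace (B i)" "\<And>i. i \<in> I \<Longrightarrow> \<not> V \<subseteq> B i"
  obtains n where "n \<in> V" "\<And>i. i \<in> I \<Longrightarrow> n \<notin> B i"
proof -
  have "\<exists>n\<in>V. \<forall>i\<in>I. n \<notin> B i"
    using assms(1,3,4)
  proof (induction I)
    case empty
    then show ?case using subspace_0[OF assms(2)] by blast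
  next
    case (insert j I)
    obtain n where n: "n \<in> V" "\<forall>i\<in>I. n \<notin> B i"
      using insert.IH insert.prems by (meson insertCI)
    obtain m where m: "m \<in> V" "m \<notin> B j" using insert.prems(2)[of j] by auto
    \<comment> \<open>the line through \<open>n\<close> in direction \<open>m\<close> meets each \<open>B i\<close> at most once\<close>
    have one: "t = t'" if i: "i \<in> insert j I" and "n + t *\<^sub>R m \<in> B i" "n + t' *\<^sub>R m \<in> B i" for i t t'
    proof (rule ccontr)
      assume ne: "t \<noteq> t'"
      have sub: "subspace (B i)" using insert.prems(1)[OF i] .
      have "(n + t *\<^sub>R m) - (n + t' *\<^sub>R m) \<in> B i" using sub that(2,3) by (rule subspace_diff)
      then have "(t - t') *\<^sub>R m \<in> B i" by (simp add: algebra_simps)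
      then have "(1 / (t - t')) *\<^sub>R (t - t') *\<^sub>R m \<in> B i" by (rule subspace_scale[OF sub])
      then have mi: "m \<in> B i" using ne by simp
      have "(n + t *\<^sub>R m) - t *\<^sub>R m \<in> B i" using sub that(2) mi by (intro subspace_diff subspace_scale)
      then have "n \<in> B i" by simp
      then show False using mi m(2) n(2) i by auto
    qed
    have "finite {t. n + t *\<^sub>R m \<in> B i}" if "i \<in> insert j I" for i
    proof (cases "\<exists>t. n + t *\<^sub>R m \<in> B i")
      case True
      then obtain t where "n + t *\<^sub>R m \<in> B i" by blast
      then have "{t. n + t *\<^sub>R m \<in> B i} \<subseteq> {t}" using one[OF that] by blast
      then show ?thesis by (rule finite_subset) simp
    qed simp
    then have "finite (\<Union>i\<in>insert j I. {t. n + t *\<^sub>R m \<in> B i})"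
      using insert.hyps(1) by blast
    then obtain t where "t \<notin> (\<Union>i\<in>insert j I. {t. n + t *\<^sub>R m \<in> B i})"
      using ex_new_if_finite[OF infinite_UNIV_char_0] by blast
    moreover have "n + t *\<^sub>R m \<in> V" using assms(2) n(1) m(1) by (intro subspace_add subspace_scale)
    ultimately show ?case by blast
  qed
  then show ?thesis using that by blast
qed

lemma unit_normal_avoiding_subspaces:
  fixes u :: "'a::euclidean_space" and B :: "'i \<Rightarrow> 'a set"
  assumes "2 \<le> DIM('a)" "finite I" "\<And>i. i \<in> I \<Longrightarrow> subspace (B i)"
    "\<And>i. i \<in> I \<Longrightarrow> \<exists>m. m \<bullet> u = 0 \<and> m \<notin> B i"
  obtains n where "n \<bullet> u = 0" "norm n = 1" "\<And>i. i \<in> I \<Longrightarrow> n \<notin> B i"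
proof -
  let ?V = "{m. m \<bullet> u = 0}"
  have V: "subspace ?V" by (simp add: subspace_def inner_add_left)
  \<comment> \<open>The extra index \<open>None\<close> carries the zero subspace, so that the
    vector found is non-zero and can be normalised.\<close>
  define B' where "B' j = (case j of None \<Rightarrow> {0} | Some i \<Rightarrow> B i)" for j
  obtain m where m: "m \<noteq> 0" "orthogonal u m" by (rule orthogonal_to_vector_exists[OF assms(1)])
  obtain n where n: "n \<in> ?V" "\<And>j. j \<in> insert None (Some ` I) \<Longrightarrow> n \<notin> B' j"
  proof (rule avoid_subspaces[of "insert None (Some ` I)" ?V B'])
    show "\<not> ?V \<subseteq> B' j" if "j \<in> insert None (Some ` I)" for j
    proof (cases j)
      case None
      then show ?thesis using m by (auto simp: B'_def orthogonal_def inner_commute)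
    next
      case (Some i)
      then show ?thesis using that assms(4)[of i] by (auto simp: B'_def)
    qed
  qed (use assms V in \<open>auto simp: B'_def subspace_def[of "{0}"]\<close>)
  have n0: "n \<noteq> 0" using n(2)[of None] by (auto simp: B'_def)
  show ?thesis
  proof (rule that[of "n /\<^sub>R norm n"])
    show "n /\<^sub>R norm n \<notin> B i" if i: "i \<in> I" for i
    proof
      assume "n /\<^sub>R norm n \<in> B i"
      then have "norm n *\<^sub>R (n /\<^sub>R norm n) \<in> B i" by (rule subspace_scale[OF assms(3)[OF i]])
      then have "n \<in> B i" using n0 by simp
      then show False using n(2)[of "Some i"] i by (simp add: B'_def)
    qed
  qed (use n n0 in auto)
qed

text \<open>A regular curve in coordinates centred at the vertex, with tangent
  \<open>\<tau>\<close>. Testing against all linear functionals reduces everything to germs of real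
  functions.\<close>

definition curve_germ :: "(real \<Rightarrow> 'a::euclidean_space) \<Rightarrow> 'a \<Rightarrow> bool" where
  "curve_germ c \<tau> \<longleftrightarrow> (\<forall>b. hol_germ (\<lambda>t. b \<bullet> c t)) \<and> c 0 = 0 \<and> \<tau> \<noteq> 0 \<and>
     (\<forall>b. ((\<lambda>t. b \<bullet> c t) has_real_derivative b \<bullet> \<tau>) (at 0))"

lemma DERIV_pos_at_right:
  fixes x :: "real \<Rightarrow> real"
  assumes "(x has_real_derivative a) (at 0)" "x 0 = 0" "a > 0"
  shows "\<forall>\<^sub>F t in at_right 0. x t > 0"
proof -
  have "\<forall>\<^sub>F t in at_right 0. (x t > 0 \<longleftrightarrow> t > 0) \<and> (x t < 0 \<longleftrightarrow> t < 0)"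
    using DERIV_pos_sign[OF assms] unfolding eventually_at_filter by eventually_elim simp
  with eventually_at_right_less[of "0::real"] show ?thesis by eventually_elim simp
qed

lemma DERIV_filterlim_at_right:
  fixes x :: "real \<Rightarrow> real"
  assumes "(x has_real_derivative a) (at 0)" "x 0 = 0" "a > 0"
  shows "filterlim x (at_right 0) (at_right 0)"
proof -
  have "isCont x 0" using assms(1) by (rule DERIV_isCont)
  then have "(x \<longlongrightarrow> 0) (at_right 0)"
    using assms(2) by (auto simp: isCont_def intro: tendsto_within_subset)
  then show ?thesis
    using DERIV_pos_at_right[OF assms] by (auto simp: filterlim_at elim: eventually_mono)
qed

text \<open>\<open>y\<close> inverts the \<open>u\<close>-coordinate of the curve, so
  \<open>c (y x)\<close> describes the curve as a graph over \<open>x\<close>. The two limits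
  transport eventual statements between the curve parameter and \<open>x\<close>.\<close>

lemma curve_germ_graph:
  assumes c: "curve_germ c \<tau>" and u: "u \<bullet> \<tau> > 0"
  obtains y where "hol_germ y" "y 0 = 0" "\<And>b. hol_germ (\<lambda>x. b \<bullet> c (y x))"
    "\<forall>\<^sub>F t in at_right 0. y (u \<bullet> c t) = t"
    "\<forall>\<^sub>F x in at_right 0. u \<bullet> c (y x) = x"
    "filterlim y (at_right 0) (at_right 0)"
    "filterlim (\<lambda>t. u \<bullet> c t) (at_right 0) (at_right 0)"
proof -
  let ?x = "\<lambda>t. u \<bullet> c t"
  have germ: "\<And>b. hol_germ (\<lambda>t. b \<bullet> c t)" and c0: "c 0 = 0"
    and der: "(?x has_real_derivative u \<bullet> \<tau>) (at 0)"
    using c by (auto simp: curve_germ_def)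
  have x0: "?x 0 = 0" by (simp add: c0)
  obtain y where y: "hol_germ y" "y 0 = 0" "\<forall>\<^sub>F t in nhds 0. y (?x t) = t" "\<forall>\<^sub>F x in nhds 0. ?x (y x) = x"
    by (rule hol_germ_inverse[OF germ[of u] x0 der u]) (rule that)
  have ev: "\<forall>\<^sub>F t in at_right 0. P t" if "\<forall>\<^sub>F t in nhds 0. P t" for P :: "real \<Rightarrow> bool"
    using that unfolding eventually_at_filter by eventually_elim simp
  have "isCont y 0" using y(1) by (rule hol_germ_isCont)
  then have "(y \<longlongrightarrow> 0) (nhds 0)" using y(2) continuous_at_imp_continuous_within by (metis isCont_def tendsto_nhds_iff)
  then have "\<forall>\<^sub>F x in nhds 0. (?x (y x) > 0 \<longleftrightarrow> y x > 0) \<and> (?x (y x) < 0 \<longleftrightarrow> y x < 0)"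
    by (rule eventually_compose_filterlim[OF DERIV_pos_sign[OF der x0 u]])
  with y(4) have "\<forall>\<^sub>F x in nhds 0. x > 0 \<longrightarrow> y x > 0"
    by eventually_elim simp
  then have ypos: "\<forall>\<^sub>F x in at_right 0. y x > 0"
    using eventually_at_right_less[of "0::real"] by (auto dest!: ev elim: eventually_elim2)
  have "(y \<longlongrightarrow> 0) (at_right 0)"
    using \<open>isCont y 0\<close> y(2) by (auto simp: isCont_def intro: tendsto_within_subset)
  then have fy: "filterlim y (at_right 0) (at_right 0)"
    using ypos by (auto simp: filterlim_at elim: eventually_mono)
  show ?thesis
    by (rule that[OF y(1,2) hol_germ_compose[OF germ y(1,2)] ev[OF y(3)] ev[OF y(4)] fy
          DERIV_filterlim_at_right[OF der x0 u]])
qed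

lemma max_square_poly_derivative_0:
  "((\<lambda>x. (max 0 x)\<^sup>2 * poly P x) has_real_derivative 0) (at 0)"
proof -
  have "((\<lambda>x. max 0 x * poly P x) \<longlongrightarrow> max 0 0 * poly P 0) (at 0)"
    by (intro tendsto_intros)
  then have "((\<lambda>x. max 0 x * poly P x) \<longlongrightarrow> 0) (at 0)" by simp
  then have "((\<lambda>h. ((max 0 h)\<^sup>2 * poly P h - (max 0 0)\<^sup>2 * poly P 0) / (h - 0)) \<longlongrightarrow> 0) (at 0)"
  proof (rule Lim_transform_eventually)
    show "\<forall>\<^sub>F h::real in at 0. max 0 h * poly P h = ((max 0 h)\<^sup>2 * poly P h - (max 0 0)\<^sup>2 * poly P 0) / (h - 0)"
      unfolding eventually_at_filter
      by (rule always_eventually) (auto simp: max_def power2_eq_square)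
  qed
  then show ?thesis by (simp add: has_field_derivative_iff)
qed

text \<open>The profile has derivative 0 at 0, so the height of the curve over the surface has
  derivative \<open>n \<bullet> \<tau>\<close>. The resulting side is thus the same for every
  \<open>P\<close>.\<close>

lemma transversal_sign:
  assumes c: "curve_germ c \<tau>" and n: "n \<bullet> \<tau> \<noteq> 0"
  shows "if n \<bullet> \<tau> > 0 then \<forall>\<^sub>F t in at_right 0. n \<bullet> c t > (max 0 (u \<bullet> c t))\<^sup>2 * poly P (u \<bullet> c t)
    else \<forall>\<^sub>F t in at_right 0. n \<bullet> c t < (max 0 (u \<bullet> c t))\<^sup>2 * poly P (u \<bullet> c t)"
proof -
  let ?Q = "\<lambda>x. (max 0 x)\<^sup>2 * poly P x"
  have c0: "c 0 = 0" and dn: "((\<lambda>t. n \<bullet> c t) has_real_derivative n \<bullet> \<tau>) (at 0)"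
    and du: "((\<lambda>t. u \<bullet> c t) has_real_derivative u \<bullet> \<tau>) (at 0)"
    using c by (auto simp: curve_germ_def)
  have "((\<lambda>t. ?Q (u \<bullet> c t)) has_real_derivative 0 * (u \<bullet> \<tau>)) (at 0)"
    by (rule DERIV_chain2[OF _ du]) (use max_square_poly_derivative_0[of P] in \<open>simp add: c0\<close>)
  from DERIV_diff[OF dn this] have d: "((\<lambda>t. n \<bullet> c t - ?Q (u \<bullet> c t)) has_real_derivative n \<bullet> \<tau>) (at 0)"
    by simp
  show ?thesis
  proof (cases "n \<bullet> \<tau> > 0")
    case True
    have "\<forall>\<^sub>F t in at_right 0. n \<bullet> c t - ?Q (u \<bullet> c t) > 0"
      by (rule DERIV_pos_at_right[OF d _ True]) (simp add: c0)
    then have "\<forall>\<^sub>F t in at_right 0. n \<bullet> c t > ?Q (u \<bullet> c t)" by (rule eventually_mono) simp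
    with True show ?thesis by simp
  next
    case False
    have "\<forall>\<^sub>F t in at_right 0. - (n \<bullet> c t - ?Q (u \<bullet> c t)) > 0"
      by (rule DERIV_pos_at_right[OF DERIV_minus[OF d]]) (use False n in \<open>auto simp: c0\<close>)
    then have "\<forall>\<^sub>F t in at_right 0. n \<bullet> c t < ?Q (u \<bullet> c t)" by (rule eventually_mono) simp
    with False show ?thesis by simp
  qed
qed

text \<open>Both graphs have \<open>u\<close>-coordinate \<open>x\<close>. If all components
  orthogonal to \<open>u\<close> agreed eventually, the projections of the finitely many basis
  vectors would make the curves coincide at arbitrarily small positive parameters.\<close>

lemma curve_germs_distinct:
  assumes c: "curve_germ c \<tau>" "u \<bullet> \<tau> > 0" and u: "norm u = 1"
    and y: "\<forall>\<^sub>F x in at_right 0. u \<bullet> c (y x) = x" "filterlim y (at_right 0) (at_right 0)"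
    and y': "\<forall>\<^sub>F x in at_right 0. u \<bullet> c' (y' x) = x" "filterlim y' (at_right 0) (at_right 0)"
    and ne: "\<And>s t. 0 < s \<Longrightarrow> s < \<delta> \<Longrightarrow> 0 < t \<Longrightarrow> t < \<delta> \<Longrightarrow> c s \<noteq> c' t" "\<delta> > 0"
  obtains n where "n \<bullet> u = 0" "\<not> (\<forall>\<^sub>F x in at_right 0. n \<bullet> (c (y x) - c' (y' x)) = 0)"
proof (rule ccontr)
  assume neg: "\<not> thesis"
  let ?w = "\<lambda>x. c (y x) - c' (y' x)"
  have all: "\<forall>\<^sub>F x in at_right 0. n \<bullet> ?w x = 0" if "n \<bullet> u = 0" for n
    using that neg \<open>\<And>n. n \<bullet> u = 0 \<Longrightarrow> \<not> (\<forall>\<^sub>F x in at_right 0. n \<bullet> (c (y x) - c' (y' x)) = 0) \<Longrightarrow> thesis\<close> by blast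
  have uu: "u \<bullet> u = 1" using u by (simp flip: power2_norm_eq_inner)
  have "\<forall>\<^sub>F x in at_right 0. \<forall>b\<in>Basis. (b - (b \<bullet> u) *\<^sub>R u) \<bullet> ?w x = 0"
    by (intro eventually_ball_finite ballI all) (auto simp: inner_diff_left uu)
  moreover have "\<forall>\<^sub>F x in at_right 0. u \<bullet> ?w x = 0"
    using y(1) y'(1) by eventually_elim (simp add: inner_diff_right)
  ultimately have "\<forall>\<^sub>F x in at_right 0. ?w x = 0"
  proof eventually_elim
    case (elim x)
    have "b \<bullet> ?w x = 0" if "b \<in> Basis" for b
    proof -
      have "(b - (b \<bullet> u) *\<^sub>R u) \<bullet> ?w x = b \<bullet> ?w x - (b \<bullet> u) * (u \<bullet> ?w x)"
        by (simp only: inner_diff_left inner_scaleR_left)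
      then show ?thesis using elim(1)[rule_format, OF that] elim(2) by simp
    qed
    then show ?case by (intro euclidean_eqI[of "?w x" 0]) (simp add: inner_commute)
  qed
  moreover have small: "\<forall>\<^sub>F t in at_right 0. 0 < t \<and> t < \<delta>"
    using eventually_at_right_less[of "0::real"] eventually_at_right_real[OF ne(2)] by eventually_elim auto
  moreover note eventually_compose_filterlim[OF small y(2)] eventually_compose_filterlim[OF small y'(2)]
  ultimately have "\<forall>\<^sub>F x in at_right (0::real). False"
    by eventually_elim (use ne(1) in force)
  then show False by simp
qed

section \<open>Polynomial profiles on both sides of an edge\<close>

lemma eventually_small_at_right: "(0::real) < \<delta> \<Longrightarrow> \<forall>\<^sub>F t in at_right 0. 0 < t \<and> t < \<delta>"
  by (rule eventually_mono[OF eventually_at_right_real]) auto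

text \<open>Two factors \<open>t\<close> split off, so
  \<open>Z t = t^2 * (P t + t^(N+1) * g t)\<close>. Changing \<open>P\<close> by \<open>t^N\<close>
  in either direction moves the profile by \<open>t^(N+2)\<close>, which beats the remainder as soon
  as \<open>\<bar>t * g t\<bar> < 1\<close>; the same bound produces the constant 2.\<close>

lemma pinching_polynomials:
  assumes Z: "hol_germ Z" "Z 0 = 0" "(Z has_real_derivative 0) (at 0)"
  obtains P P' where
    "\<forall>\<^sub>F x in at_right 0. Z x < (max 0 x)\<^sup>2 * poly P x \<and> (max 0 x)\<^sup>2 * poly P x \<le> Z x + 2 * x ^ (N + 2)"
    "\<forall>\<^sub>F x in at_right 0. (max 0 x)\<^sup>2 * poly P' x < Z x \<and> Z x - 2 * x ^ (N + 2) \<le> (max 0 x)\<^sup>2 * poly P' x"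
proof -
  obtain h1 where h1: "hol_germ h1" "\<And>t. Z t = Z 0 + t * h1 t"
    by (rule hol_germ_factor[OF Z(1)]) (rule that)
  have h10: "h1 0 = 0" using DERIV_unique[OF hol_germ_derivative[OF h1] Z(3)] .
  obtain h2 where h2: "hol_germ h2" "\<And>t. h1 t = h1 0 + t * h2 t"
    by (rule hol_germ_factor[OF h1(1)]) (rule that)
  obtain P g where g: "hol_germ g" "\<And>t. h2 t = poly P t + t ^ (N + 1) * g t"
    by (rule hol_germ_Taylor[OF h2(1)]) (rule that)
  have Zeq: "Z t = t\<^sup>2 * (poly P t + t ^ (N + 1) * g t)" for t
    using h1(2)[of t] h2(2)[of t] by (simp add: h10 Z(2) g(2) power2_eq_square)
  have "isCont (\<lambda>t. t * g t) 0" using hol_germ_isCont[OF g(1)] by (intro continuous_intros)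
  then have "((\<lambda>t. t * g t) \<longlongrightarrow> 0) (at_right 0)"
    by (auto simp: isCont_def intro: tendsto_within_subset)
  then have "\<forall>\<^sub>F t in at_right 0. dist (t * g t) 0 < 1" by (rule tendstoD) simp
  then have ev: "\<forall>\<^sub>F t in at_right 0. 0 < t \<and> \<bar>t * g t\<bar> < 1"
    using eventually_at_right_less[of "0::real"] by eventually_elim simp
  show ?thesis
  proof (rule that[of "P + monom 1 N" "P - monom 1 N"])
    show "\<forall>\<^sub>F x in at_right 0. Z x < (max 0 x)\<^sup>2 * poly (P + monom 1 N) x \<and>
        (max 0 x)\<^sup>2 * poly (P + monom 1 N) x \<le> Z x + 2 * x ^ (N + 2)"
      using ev
    proof eventually_elim
      case (elim x)
      have "(max 0 x)\<^sup>2 * poly (P + monom 1 N) x - Z x = x ^ (N + 2) * (1 - x * g x)"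
        using elim by (simp add: Zeq poly_monom algebra_simps power2_eq_square)
      moreover have "0 < x ^ (N + 2) * (1 - x * g x)"
        using elim by (intro mult_pos_pos zero_less_power) auto
      moreover have "x ^ (N + 2) * (1 - x * g x) \<le> x ^ (N + 2) * 2"
        using elim by (intro mult_left_mono) auto
      ultimately show ?case by linarith
    qed
    show "\<forall>\<^sub>F x in at_right 0. (max 0 x)\<^sup>2 * poly (P - monom 1 N) x < Z x \<and>
        Z x - 2 * x ^ (N + 2) \<le> (max 0 x)\<^sup>2 * poly (P - monom 1 N) x"
      using ev
    proof eventually_elim
      case (elim x)
      have "Z x - (max 0 x)\<^sup>2 * poly (P - monom 1 N) x = x ^ (N + 2) * (1 + x * g x)"
        using elim by (simp add: Zeq poly_monom algebra_simps power2_eq_square)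
      moreover have "0 < x ^ (N + 2) * (1 + x * g x)"
        using elim by (intro mult_pos_pos zero_less_power) auto
      moreover have "x ^ (N + 2) * (1 + x * g x) \<le> x ^ (N + 2) * 2"
        using elim by (intro mult_left_mono) auto
      ultimately show ?case by linarith
    qed
  qed
qed

lemma eventually_power_dominated:
  assumes "k > 0" "q \<le> N"
  shows "\<forall>\<^sub>F x in at_right (0::real). 2 * x ^ (N + 2) < k * x ^ q"
proof -
  have "min 1 (k / 2) > 0" using assms(1) by simp
  from eventually_small_at_right[OF this] show ?thesis
  proof eventually_elim
    case (elim x)
    have "x ^ (N + 2) \<le> x ^ (q + 1)" using elim assms(2) by (intro power_decreasing) auto
    also have "x ^ (q + 1) = x * x ^ q" by simp
    also have "x * x ^ q < k / 2 * x ^ q" using elim by (intro mult_strict_right_mono) auto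
    finally show ?case by simp
  qed
qed

text \<open>The three alternatives for another edge are: above both profiles, below both, or running
  where the profiles coincide. Each of them makes the two type indicators equal.\<close>

lemma separating_polynomials:
  fixes c :: "'e \<Rightarrow> real \<Rightarrow> 'a::euclidean_space"
  assumes dim: "2 \<le> DIM('a)" and fin: "finite E" and e0: "e0 \<in> E"
    and germ: "\<And>e. e \<in> E \<Longrightarrow> curve_germ (c e) (\<tau> e)"
    and disj: "\<And>e s t. e \<in> E \<Longrightarrow> e \<noteq> e0 \<Longrightarrow> 0 < s \<Longrightarrow> s < \<delta> \<Longrightarrow> 0 < t \<Longrightarrow> t < \<delta> \<Longrightarrow> c e s \<noteq> c e0 t" "\<delta> > 0"
  obtains u n P P' where "norm u = 1" "norm n = 1" "n \<bullet> u = 0"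
    "\<forall>\<^sub>F t in at_right 0. n \<bullet> c e0 t < (max 0 (u \<bullet> c e0 t))\<^sup>2 * poly P (u \<bullet> c e0 t)"
    "\<forall>\<^sub>F t in at_right 0. n \<bullet> c e0 t > (max 0 (u \<bullet> c e0 t))\<^sup>2 * poly P' (u \<bullet> c e0 t)"
    "\<And>e. e \<in> E \<Longrightarrow> e \<noteq> e0 \<Longrightarrow>
      (\<forall>\<^sub>F t in at_right 0. n \<bullet> c e t > (max 0 (u \<bullet> c e t))\<^sup>2 * poly P (u \<bullet> c e t)) \<and>
      (\<forall>\<^sub>F t in at_right 0. n \<bullet> c e t > (max 0 (u \<bullet> c e t))\<^sup>2 * poly P' (u \<bullet> c e t)) \<or>
      (\<forall>\<^sub>F t in at_right 0. n \<bullet> c e t < (max 0 (u \<bullet> c e t))\<^sup>2 * poly P (u \<bullet> c e t)) \<and>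
      (\<forall>\<^sub>F t in at_right 0. n \<bullet> c e t < (max 0 (u \<bullet> c e t))\<^sup>2 * poly P' (u \<bullet> c e t)) \<or>
      (\<forall>\<^sub>F t in at_right 0. (max 0 (u \<bullet> c e t))\<^sup>2 * poly P (u \<bullet> c e t) = (max 0 (u \<bullet> c e t))\<^sup>2 * poly P' (u \<bullet> c e t))"
proof -
  define u where "u = \<tau> e0 /\<^sub>R norm (\<tau> e0)"
  have \<tau>0: "\<tau> e0 \<noteq> 0" using germ[OF e0] by (simp add: curve_germ_def)
  then have u: "norm u = 1" by (simp add: u_def)
  then have uu: "u \<bullet> u = 1" by (simp flip: power2_norm_eq_inner)
  have \<tau>0u: "\<tau> e0 = norm (\<tau> e0) *\<^sub>R u" using \<tau>0 by (simp add: u_def)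
  have up0: "u \<bullet> \<tau> e0 > 0" using \<tau>0 by (subst \<tau>0u) (simp add: uu)
  define reparam where "reparam e y \<longleftrightarrow> hol_germ y \<and> y 0 = 0 \<and> (\<forall>b. hol_germ (\<lambda>x. b \<bullet> c e (y x))) \<and>
    (\<forall>\<^sub>F t in at_right 0. y (u \<bullet> c e t) = t) \<and> (\<forall>\<^sub>F x in at_right 0. u \<bullet> c e (y x) = x) \<and>
    filterlim y (at_right 0) (at_right 0) \<and> filterlim (\<lambda>t. u \<bullet> c e t) (at_right 0) (at_right 0)" for e y
  define y where "y e = (SOME y. reparam e y)" for e
  have "\<exists>y. reparam e y" if "e \<in> E" "u \<bullet> \<tau> e > 0" for e
    unfolding reparam_def by (rule curve_germ_graph[OF germ[OF that(1)] that(2)]) blast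
  then have "reparam e (y e)" if "e \<in> E" "u \<bullet> \<tau> e > 0" for e
    unfolding y_def by (rule someI_ex) (use that in auto)
  note y = this[unfolded reparam_def]
  define W where "W e x = c e (y e x)" for e x
  define trans where "trans e \<longleftrightarrow> \<tau> e \<noteq> (u \<bullet> \<tau> e) *\<^sub>R u" for e
  \<comment> \<open>The edges that restrict the choice of the normal; those leaving exactly opposite
    to \<open>u\<close> are left out.\<close>
  define I where "I = {e \<in> E. e \<noteq> e0 \<and> (trans e \<or> u \<bullet> \<tau> e > 0)}"
  \<comment> \<open>The bad normals: those whose orthogonal hyperplane contains the tangent of a
    transversal edge, or those that do not distinguish a tangent edge from \<open>e0\<close> near
    the vertex.\<close>
  define B where "B e = (if trans e then {n. n \<bullet> \<tau> e = 0} else {n. \<forall>\<^sub>F x in at_right 0. n \<bullet> (W e x - W e0 x) = 0})" for e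
  obtain n where n: "n \<bullet> u = 0" "norm n = 1" "\<And>e. e \<in> I \<Longrightarrow> n \<notin> B e"
  proof (rule unit_normal_avoiding_subspaces[OF dim, of I B u])
    show "finite I" using fin by (simp add: I_def)
    show "subspace (B e)" for e
    proof (cases "trans e")
      case True
      then show ?thesis by (simp add: B_def subspace_def inner_add_left)
    next
      case False
      then show ?thesis
        unfolding B_def subspace_def
        by (auto simp: inner_add_left elim: eventually_elim2 eventually_mono)
    qed
    show "\<exists>m. m \<bullet> u = 0 \<and> m \<notin> B e" if e: "e \<in> I" for e
    proof (cases "trans e")
      case True
      \<comment> \<open>The part of the tangent orthogonal to \<open>u\<close>; its inner product
        with the tangent is its own squared norm.\<close>
      let ?m = "\<tau> e - (u \<bullet> \<tau> e) *\<^sub>R u"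
      have mu: "?m \<bullet> u = 0" by (simp add: inner_diff_left uu inner_commute[of "\<tau> e"])
      have "?m \<bullet> \<tau> e = ?m \<bullet> (?m + (u \<bullet> \<tau> e) *\<^sub>R u)" by simp
      also have "\<dots> = ?m \<bullet> ?m" using mu by (simp only: inner_add_right inner_scaleR_right mult_zero_right add_0_right)
      also have "\<dots> \<noteq> 0" using True by (simp add: trans_def)
      finally show ?thesis using mu True by (auto simp: B_def)
    next
      case False
      with e have e': "e \<in> E" "e \<noteq> e0" "u \<bullet> \<tau> e > 0" by (auto simp: I_def)
      obtain m where "m \<bullet> u = 0" "\<not> (\<forall>\<^sub>F x in at_right 0. m \<bullet> (c e (y e x) - c e0 (y e0 x)) = 0)"
        by (rule curve_germs_distinct[OF germ[OF e'(1)] e'(3) u, of "y e" "c e0" "y e0" \<delta>])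
          (use y[OF e'(1,3)] y[OF e0 up0] disj e'(1,2) in auto)
      then show ?thesis using False by (auto simp: B_def W_def)
    qed
  qed (rule that)
  \<comment> \<open>The profile of \<open>e0\<close> seen in the plane of \<open>u\<close> and
    \<open>n\<close>, as a function of \<open>x\<close>.\<close>
  define Z where "Z x = n \<bullet> W e0 x" for x
  have gZ: "hol_germ Z" unfolding Z_def W_def using y[OF e0 up0] by blast
  have c0: "c e 0 = 0" if "e \<in> E" for e using germ[OF that] by (simp add: curve_germ_def)
  have Z0: "Z 0 = 0" using y[OF e0 up0] c0[OF e0] by (simp add: Z_def W_def)
  obtain y1 where y1: "hol_germ y1" "\<And>t. y e0 t = y e0 0 + t * y1 t"
    by (rule hol_germ_factor[of "y e0"]) (use y[OF e0 up0] in blast, rule that)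
  have "n \<bullet> \<tau> e0 = 0" by (subst \<tau>0u) (simp add: n(1))
  then have "((\<lambda>t. n \<bullet> c e0 t) has_real_derivative 0) (at (y e0 0))"
    using germ[OF e0] y[OF e0 up0] unfolding curve_germ_def by metis
  then have "(Z has_real_derivative 0 * y1 0) (at 0)"
    unfolding Z_def W_def by (rule DERIV_chain2) (rule hol_germ_derivative[OF y1])
  then have dZ: "(Z has_real_derivative 0) (at 0)" by simp
  \<comment> \<open>\<open>q\<close> bounds the order of contact between the profiles of
    \<open>e\<close> and \<open>e0\<close>, with \<open>k\<close> a lower bound for the leading size
    of their difference.\<close>
  define bound where "bound e k q \<longleftrightarrow> k > 0 \<and>
    ((\<forall>\<^sub>F x in at_right 0. n \<bullet> W e x - Z x \<ge> k * x ^ q) \<or> (\<forall>\<^sub>F x in at_right 0. n \<bullet> W e x - Z x \<le> - (k * x ^ q)))"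
    for e k q
  have "\<exists>k q. bound e k q" if "e \<in> I" "\<not> trans e" for e
  proof -
    from that have e: "e \<in> E" "u \<bullet> \<tau> e > 0" by (auto simp: I_def)
    have "hol_germ (\<lambda>x. n \<bullet> W e x - Z x)"
      using y[OF e] gZ unfolding W_def by (intro hol_germ_diff) auto
    moreover have "\<not> (\<forall>\<^sub>F x in at_right 0. n \<bullet> W e x - Z x = 0)"
      using n(3)[OF that(1)] that(2) by (simp add: B_def Z_def inner_diff_right)
    ultimately show ?thesis using hol_germ_order[of "\<lambda>x. n \<bullet> W e x - Z x"] unfolding bound_def by blast
  qed
  then obtain k q where "\<And>e. e \<in> I \<Longrightarrow> \<not> trans e \<Longrightarrow> bound e (k e) (q e)" by metis
  note kq = this[unfolded bound_def]
  \<comment> \<open>Any common upper bound of the contact exponents would do; the sum is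
    one.\<close>
  define N where "N = (\<Sum>e\<in>I. q e)"
  have finI: "finite I" using fin by (simp add: I_def)
  let ?Q = "\<lambda>P x. (max 0 x)\<^sup>2 * poly P (x::real)"
  obtain P P' where
    P: "\<forall>\<^sub>F x in at_right 0. Z x < ?Q P x \<and> ?Q P x \<le> Z x + 2 * x ^ (N + 2)" and
    P': "\<forall>\<^sub>F x in at_right 0. ?Q P' x < Z x \<and> Z x - 2 * x ^ (N + 2) \<le> ?Q P' x"
    by (rule pinching_polynomials[OF gZ Z0 dZ]) (rule that)
  \<comment> \<open>Inequalities between graphs over \<open>x\<close> become inequalities along the
    edge by substituting its own \<open>u\<close>-coordinate.\<close>
  have along: "\<forall>\<^sub>F t in at_right 0. R (n \<bullet> c e t) (u \<bullet> c e t)"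
    if "e \<in> E" "u \<bullet> \<tau> e > 0" "\<forall>\<^sub>F x in at_right 0. R (n \<bullet> W e x) x" for R e
  proof -
    have "\<forall>\<^sub>F t in at_right 0. R (n \<bullet> W e (u \<bullet> c e t)) (u \<bullet> c e t)"
      by (rule eventually_compose_filterlim[OF that(3)]) (use y[OF that(1,2)] in blast)
    moreover have "\<forall>\<^sub>F t in at_right 0. y e (u \<bullet> c e t) = t" using y[OF that(1,2)] by blast
    ultimately show ?thesis by eventually_elim (simp add: W_def)
  qed
  show ?thesis
  proof (rule that[OF u n(2,1)])
    show "\<forall>\<^sub>F t in at_right 0. n \<bullet> c e0 t < ?Q P (u \<bullet> c e0 t)"
      by (rule along[OF e0 up0, of "\<lambda>z x. z < ?Q P x"], rule eventually_mono[OF P]) (simp add: Z_def)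
    show "\<forall>\<^sub>F t in at_right 0. n \<bullet> c e0 t > ?Q P' (u \<bullet> c e0 t)"
      by (rule along[OF e0 up0, of "\<lambda>z x. z > ?Q P' x"], rule eventually_mono[OF P']) (simp add: Z_def)
  next
    fix e assume e: "e \<in> E" "e \<noteq> e0"
    let ?R = "\<lambda>r. (\<forall>\<^sub>F t in at_right 0. r (n \<bullet> c e t) (?Q P (u \<bullet> c e t))) \<and> (\<forall>\<^sub>F t in at_right 0. r (n \<bullet> c e t) (?Q P' (u \<bullet> c e t)))"
    show "?R (\<lambda>a b. b < a) \<or> ?R (<) \<or> (\<forall>\<^sub>F t in at_right 0. ?Q P (u \<bullet> c e t) = ?Q P' (u \<bullet> c e t))"
    proof (cases "trans e")
      case True
      then have "n \<bullet> \<tau> e \<noteq> 0" using n(3)[of e] e by (simp add: I_def B_def)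
      from transversal_sign[OF germ[OF e(1)] this, of u P] transversal_sign[OF germ[OF e(1)] this, of u P']
      show ?thesis by (cases "n \<bullet> \<tau> e > 0") simp_all
    next
      case False
      have "\<tau> e \<noteq> 0" using germ[OF e(1)] by (simp add: curve_germ_def)
      then have nz: "u \<bullet> \<tau> e \<noteq> 0" using False by (auto simp: trans_def)
      show ?thesis
      proof (cases "u \<bullet> \<tau> e > 0")
        case True
        then have eI: "e \<in> I" using e by (simp add: I_def)
        have "q e \<le> N" unfolding N_def by (rule member_le_sum) (use eI finI in auto)
        \<comment> \<open>The pinching width is eventually smaller than the gap to \<open>e\<close>,
          so neither polynomial profile crosses this edge.\<close>
        then have dom: "\<forall>\<^sub>F x in at_right 0. 2 * x ^ (N + 2) < k e * x ^ q e"
          using kq[OF eI False] by (intro eventually_power_dominated) auto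
        from kq[OF eI False] consider
          "\<forall>\<^sub>F x in at_right 0. n \<bullet> W e x - Z x \<ge> k e * x ^ q e" |
          "\<forall>\<^sub>F x in at_right 0. n \<bullet> W e x - Z x \<le> - (k e * x ^ q e)" by blast
        then show ?thesis
        proof cases
          case 1
          have "?R (\<lambda>a b. b < a)"
          proof (intro conjI along[OF e(1) True, of "\<lambda>z x. z > ?Q P x"] along[OF e(1) True, of "\<lambda>z x. z > ?Q P' x"])
            show "\<forall>\<^sub>F x in at_right 0. n \<bullet> W e x > ?Q P x" using 1 dom P by eventually_elim linarith
            show "\<forall>\<^sub>F x in at_right 0. n \<bullet> W e x > ?Q P' x"
              using 1 dom P' eventually_at_right_less[of "0::real"]
            proof eventually_elim
              case (elim x)
              moreover have "0 < x ^ (N + 2)" using elim by simp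
              ultimately show ?case by linarith
            qed
          qed
          then show ?thesis by blast
        next
          case 2
          have "?R (<)"
          proof (intro conjI along[OF e(1) True, of "\<lambda>z x. z < ?Q P x"] along[OF e(1) True, of "\<lambda>z x. z < ?Q P' x"])
            show "\<forall>\<^sub>F x in at_right 0. n \<bullet> W e x < ?Q P x"
              using 2 dom P eventually_at_right_less[of "0::real"]
            proof eventually_elim
              case (elim x)
              moreover have "0 < x ^ (N + 2)" using elim by simp
              ultimately show ?case by linarith
            qed
            show "\<forall>\<^sub>F x in at_right 0. n \<bullet> W e x < ?Q P' x" using 2 dom P' by eventually_elim linarith
          qed
          then show ?thesis by blast
        qed
      next
        case neg: False
        \<comment> \<open>The edge starts into \<open>x < 0\<close>, where both profiles are
          0.\<close>
        have "((\<lambda>t. - (u \<bullet> c e t)) has_real_derivative - (u \<bullet> \<tau> e)) (at 0)"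
          using germ[OF e(1)] by (intro DERIV_minus) (simp add: curve_germ_def)
        then have "\<forall>\<^sub>F t in at_right 0. - (u \<bullet> c e t) > 0"
          by (rule DERIV_pos_at_right) (use neg nz c0[OF e(1)] in auto)
        then have "\<forall>\<^sub>F t in at_right 0. ?Q P (u \<bullet> c e t) = ?Q P' (u \<bullet> c e t)"
          by eventually_elim (simp add: max_absorb1)
        then show ?thesis by blast
      qed
    qed
  qed
qed

subsection \<open>Surfaces isolating an edge\<close>

lemma real_analytic_curve_germ:
  fixes g :: "real \<Rightarrow> 'a::euclidean_space"
  assumes g: "real_analytic_at g 0" and nz: "vector_derivative g (at 0) \<noteq> 0"
  shows "curve_germ (\<lambda>t. g t - g 0) (vector_derivative g (at 0))"
proof -
  have germ: "hol_germ (\<lambda>t. b \<bullet> (g t - g 0))" for b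
    using hol_germ_diff[OF real_analytic_hol_germ[OF g, of b] hol_germ_const[of "b \<bullet> g 0"]]
    by (simp add: inner_diff_right inner_commute[of b])
  \<comment> \<open>Differentiability is established componentwise, since only then is
    \<open>vector_derivative\<close> an actual derivative.\<close>
  have "(\<lambda>t. g t \<bullet> b) differentiable (at 0)" for b
  proof -
    obtain h1 where h1: "hol_germ h1" "\<And>t. g t \<bullet> b = g 0 \<bullet> b + t * h1 t"
      by (rule hol_germ_factor[OF real_analytic_hol_germ[OF g, of b]]) (rule that)
    show ?thesis using hol_germ_derivative[OF h1] unfolding real_differentiable_def by blast
  qed
  then have "g differentiable (at 0)"
    by (subst differentiable_componentwise_within) auto
  then have gd: "(g has_vector_derivative vector_derivative g (at 0)) (at 0)"
    by (simp add: vector_derivative_works)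
  have "((\<lambda>t. b \<bullet> (g t - g 0)) has_real_derivative b \<bullet> vector_derivative g (at 0)) (at 0)" for b
  proof -
    have "((\<lambda>t. g t - g 0) has_vector_derivative vector_derivative g (at 0) - 0) (at 0)"
      by (intro has_vector_derivative_diff gd has_vector_derivative_const)
    from bounded_linear.has_vector_derivative[OF bounded_linear_inner_right[of b] this]
    show ?thesis by (simp add: has_real_derivative_iff_has_vector_derivative)
  qed
  then show ?thesis using germ nz by (simp add: curve_germ_def)
qed

text \<open>A common point would have to be an endpoint of both edges, but on a simple path an
  interior parameter never reaches an endpoint, even if the edge is a loop.\<close>

lemma analytic_graph_edges_disjoint:
  assumes g: "analytic_graph \<A> \<gamma>" and ne: "e \<noteq> e'" and st: "0 < s" "s < 1" "0 < t" "t < 1"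
  shows "\<gamma> e s \<noteq> \<gamma> e' t"
proof
  assume eq: "\<gamma> e s = \<gamma> e' t"
  have "\<gamma> e s \<in> path_image (\<gamma> e) \<inter> path_image (\<gamma> e')"
    using st imageI[of s "{0..1}" "\<gamma> e"] imageI[of t "{0..1}" "\<gamma> e'"] by (simp add: path_image_def eq)
  then have "\<gamma> e s \<in> {\<gamma> e 0, \<gamma> e 1}"
    using g ne unfolding analytic_graph_def pathstart_def pathfinish_def by blast
  moreover have "simple_path (\<gamma> e)"
    using g by (simp add: analytic_graph_def analytic_edge_def)
  ultimately show False
    using st unfolding simple_path_def loop_free_def
    by (metis atLeastAtMost_iff empty_iff insert_iff less_imp_le less_irrefl order_refl zero_le_one)
qed

text \<open>The edge itself is known only for parameters in \<open>{0..1}\<close>; the analytic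
  function \<open>g\<close> supplies the two-sided extension at 0.\<close>

lemma analytic_edge_germ:
  assumes e: "analytic_edge \<A> e" and chart: "(U, \<phi>) \<in> \<A>" "e 0 \<in> U"
  obtains c \<tau> where "curve_germ c \<tau>" "\<forall>\<^sub>F t in at_right 0. \<phi> (e t) - \<phi> (e 0) = c t"
proof -
  have "\<forall>(U, \<phi>)\<in>\<A>. e 0 \<in> U \<longrightarrow>
        (\<exists>g. real_analytic_at g 0 \<and> vector_derivative g (at 0) \<noteq> 0 \<and>
             (\<forall>\<^sub>F s in nhds 0. s \<in> {0..1} \<longrightarrow> \<phi> (e s) = g s))"
    using e unfolding analytic_edge_def by simp
  from bspec[OF this chart(1)] chart(2) obtain g where
    g: "real_analytic_at g 0" "vector_derivative g (at 0) \<noteq> 0"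
      "\<forall>\<^sub>F s in nhds 0. s \<in> {0..1} \<longrightarrow> \<phi> (e s) = g s"
    by auto
  have g0: "\<phi> (e 0) = g 0" using eventually_nhds_x_imp_x[OF g(3)] by simp
  have "\<forall>\<^sub>F s in at_right 0. s \<in> {0..1} \<longrightarrow> \<phi> (e s) = g s"
    using g(3) unfolding eventually_at_filter by eventually_elim simp
  moreover have "\<forall>\<^sub>F s in at_right (0::real). s \<in> {0<..<1}"
    by (rule eventually_at_right_real) simp
  ultimately have "\<forall>\<^sub>F t in at_right 0. \<phi> (e t) - \<phi> (e 0) = g t - g 0"
    by eventually_elim (simp add: g0)
  with real_analytic_curve_germ[OF g(1,2)] show ?thesis by (rule that)
qed

lemma path_tendsto_start:
  assumes "path e"
  shows "(e \<longlongrightarrow> e 0) (at_right 0)"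
proof -
  have "(e \<longlongrightarrow> e 0) (at 0 within {0..1})"
    using assms unfolding path_def continuous_on_def by simp
  then show ?thesis using at_within_Icc_at_right[of "0::real" 1] by simp
qed

text \<open>Both surfaces share the chart, \<open>u\<close> and \<open>n\<close>, and differ only in
  the polynomial. One profile lies above \<open>e0\<close> and the other below it, whence the
  indicators -1 and 1.\<close>

lemma isolating_surfaces:
  fixes \<A> :: "('a::{t2_space,second_countable_topology}, 'd::finite) chart set"
    and \<gamma> :: "'e::finite \<Rightarrow> real \<Rightarrow> 'a"
  assumes atlas: "analytic_atlas \<A>" and graph: "analytic_graph \<A> \<gamma>"
    and start: "\<And>e. e \<in> E \<Longrightarrow> pathstart (\<gamma> e) = v" and e0: "e0 \<in> E"
    and card: "CARD('k::finite) + 1 = CARD('d)" "CARD('d) \<ge> 2"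
  obtains S S' :: "('a, 'k::finite) surface" where "surface_through \<A> v S" "surface_through \<A> v S'"
    "type_indicator (\<gamma> e0) S = - 1" "type_indicator (\<gamma> e0) S' = 1"
    "\<And>e. e \<in> E \<Longrightarrow> e \<noteq> e0 \<Longrightarrow> type_indicator (\<gamma> e) S = type_indicator (\<gamma> e) S'"
proof -
  have "v \<in> (\<Union>(U, \<phi>)\<in>\<A>. U)" using atlas by (simp add: analytic_atlas_def)
  then obtain U \<phi> where chart: "(U, \<phi>) \<in> \<A>" "v \<in> U" by auto
  have oU: "open U" and "homeomorphism U (\<phi> ` U) \<phi> (inv_into U \<phi>)"
    using atlas chart(1) unfolding analytic_atlas_def by auto
  then have "\<And>a. a \<in> U \<Longrightarrow> inv_into U \<phi> (\<phi> a) = a"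
    unfolding homeomorphism_def by blast
  then have inj: "inj_on \<phi> U" by (rule inj_on_inverseI)
  have \<gamma>0: "\<gamma> e 0 = v" if "e \<in> E" for e using start[OF that] by (simp add: pathstart_def)
  have edge: "analytic_edge \<A> (\<gamma> e)" for e using graph by (simp add: analytic_graph_def)
  have lim: "(\<gamma> e \<longlongrightarrow> v) (at_right 0)" if "e \<in> E" for e
    using path_tendsto_start[of "\<gamma> e"] edge[of e] \<gamma>0[OF that]
    by (simp add: analytic_edge_def simple_path_imp_path)
  define germ where "germ e p \<longleftrightarrow> curve_germ (fst p) (snd p) \<and> (\<forall>\<^sub>F t in at_right 0. \<phi> (\<gamma> e t) - \<phi> v = fst p t)" for e p
  have "\<exists>p. germ e p" if "e \<in> E" for e
  proof -
    have "\<gamma> e 0 \<in> U" using \<gamma>0[OF that] chart(2) by simp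
    then obtain c \<tau> where "curve_germ c \<tau>" "\<forall>\<^sub>F t in at_right 0. \<phi> (\<gamma> e t) - \<phi> (\<gamma> e 0) = c t"
      by (rule analytic_edge_germ[OF edge[of e] chart(1)]) (rule that)
    then show ?thesis using \<gamma>0[OF that] by (intro exI[of _ "(c, \<tau>)"]) (simp add: germ_def)
  qed
  then obtain p where p: "\<And>e. e \<in> E \<Longrightarrow> germ e (p e)" by metis
  define c where "c e = fst (p e)" for e
  have c: "curve_germ (c e) (snd (p e))" "\<forall>\<^sub>F t in at_right 0. \<phi> (\<gamma> e t) - \<phi> v = c e t" if "e \<in> E" for e
    using p[OF that] by (auto simp: germ_def c_def)
  have "\<forall>\<^sub>F t in at_right 0. \<forall>e\<in>E. \<phi> (\<gamma> e t) - \<phi> v = c e t \<and> \<gamma> e t \<in> U \<and> t < 1"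
  proof (intro eventually_ball_finite ballI eventually_conj)
    fix e assume "e \<in> E"
    then show "\<forall>\<^sub>F t in at_right 0. \<gamma> e t \<in> U" using topological_tendstoD[OF lim oU chart(2)] by blast
    show "\<forall>\<^sub>F t in at_right (0::real). t < 1"
      by (rule eventually_mono[OF eventually_at_right_real[of 0 1]]) auto
  qed (use c in auto)
  then obtain \<delta> where \<delta>: "\<delta> > 0"
    "\<And>t e. 0 < t \<Longrightarrow> t < \<delta> \<Longrightarrow> e \<in> E \<Longrightarrow> \<phi> (\<gamma> e t) - \<phi> v = c e t \<and> \<gamma> e t \<in> U \<and> t < 1"
    unfolding eventually_at_right_field by blast
  \<comment> \<open>Disjointness of the open edges passes to the coordinate curves by injectivity of
    the chart; below \<open>\<delta>\<close> the curves agree with their germs.\<close>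
  have disj: "c e s \<noteq> c e0 t" if "e \<in> E" "e \<noteq> e0" "0 < s" "s < \<delta>" "0 < t" "t < \<delta>" for e s t
  proof
    assume "c e s = c e0 t"
    then have "\<phi> (\<gamma> e s) = \<phi> (\<gamma> e0 t)"
      using \<delta>(2)[OF that(3,4,1)] \<delta>(2)[OF that(5,6) e0] by (metis diff_add_cancel)
    then have "\<gamma> e s = \<gamma> e0 t"
      using inj \<delta>(2)[OF that(3,4,1)] \<delta>(2)[OF that(5,6) e0] by (auto dest: inj_onD)
    then show False
      using analytic_graph_edges_disjoint[OF graph that(2)] that \<delta>(2)[OF that(3,4,1)] \<delta>(2)[OF that(5,6) e0] by blast
  qed
  let ?Q = "\<lambda>P x. (max 0 x)\<^sup>2 * poly P (x::real)"
  obtain u n P P' where un: "norm u = 1" "norm n = 1" "n \<bullet> u = 0"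
    and P: "\<forall>\<^sub>F t in at_right 0. n \<bullet> c e0 t < ?Q P (u \<bullet> c e0 t)"
    and P': "\<forall>\<^sub>F t in at_right 0. n \<bullet> c e0 t > ?Q P' (u \<bullet> c e0 t)"
    and PP': "\<And>e. e \<in> E \<Longrightarrow> e \<noteq> e0 \<Longrightarrow>
      (\<forall>\<^sub>F t in at_right 0. n \<bullet> c e t > ?Q P (u \<bullet> c e t)) \<and> (\<forall>\<^sub>F t in at_right 0. n \<bullet> c e t > ?Q P' (u \<bullet> c e t)) \<or>
      (\<forall>\<^sub>F t in at_right 0. n \<bullet> c e t < ?Q P (u \<bullet> c e t)) \<and> (\<forall>\<^sub>F t in at_right 0. n \<bullet> c e t < ?Q P' (u \<bullet> c e t)) \<or>
      (\<forall>\<^sub>F t in at_right 0. ?Q P (u \<bullet> c e t) = ?Q P' (u \<bullet> c e t))"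
  proof (rule separating_polynomials[of E e0 c "\<lambda>e. snd (p e)" \<delta>])
    show "2 \<le> DIM(real ^ 'd)" using card(2) by simp
  qed (use e0 c(1) disj \<delta>(1) that in auto)
  define sgn_type where "sgn_type P e = (if \<forall>\<^sub>F t in at_right 0. n \<bullet> c e t > ?Q P (u \<bullet> c e t) then 1
    else if \<forall>\<^sub>F t in at_right 0. n \<bullet> c e t < ?Q P (u \<bullet> c e t) then - 1 else 0 :: int)" for P e
  have ex: "\<exists>S :: ('a, 'k) surface. surface_through \<A> v S \<and> (\<forall>e\<in>E. type_indicator (\<gamma> e) S = sgn_type P e)" for P
  proof -
    obtain S :: "('a, 'k) surface" where S: "surface_through \<A> v S"
      and ab: "\<And>c. (c \<longlongrightarrow> v) (at_right (0::real)) \<Longrightarrow>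
      (\<forall>\<^sub>F t in at_right 0. c t \<in> above S) \<longleftrightarrow>
      (\<forall>\<^sub>F t in at_right 0. n \<bullet> (\<phi> (c t) - \<phi> v) > ?Q P (u \<bullet> (\<phi> (c t) - \<phi> v)))"
      and be: "\<And>c. (c \<longlongrightarrow> v) (at_right (0::real)) \<Longrightarrow>
      (\<forall>\<^sub>F t in at_right 0. c t \<in> below S) \<longleftrightarrow>
      (\<forall>\<^sub>F t in at_right 0. n \<bullet> (\<phi> (c t) - \<phi> v) < ?Q P (u \<bullet> (\<phi> (c t) - \<phi> v)))"
      by (rule surface_exists[OF atlas chart un card(1), of P]) (rule that)
    have "type_indicator (\<gamma> e) S = sgn_type P e" if e: "e \<in> E" for e
    proof -
      have "(\<forall>\<^sub>F t in at_right 0. n \<bullet> (\<phi> (\<gamma> e t) - \<phi> v) > ?Q P (u \<bullet> (\<phi> (\<gamma> e t) - \<phi> v))) \<longleftrightarrow>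
          (\<forall>\<^sub>F t in at_right 0. n \<bullet> c e t > ?Q P (u \<bullet> c e t))"
        by (rule eventually_subst, rule eventually_mono[OF c(2)[OF e]]) simp
      moreover have "(\<forall>\<^sub>F t in at_right 0. n \<bullet> (\<phi> (\<gamma> e t) - \<phi> v) < ?Q P (u \<bullet> (\<phi> (\<gamma> e t) - \<phi> v))) \<longleftrightarrow>
          (\<forall>\<^sub>F t in at_right 0. n \<bullet> c e t < ?Q P (u \<bullet> c e t))"
        by (rule eventually_subst, rule eventually_mono[OF c(2)[OF e]]) simp
      ultimately show ?thesis
        unfolding type_indicator_def sgn_type_def ab[OF lim[OF e]] be[OF lim[OF e]] by simp
    qed
    with S show ?thesis by blast
  qed
  \<comment> \<open>\<open>type_indicator\<close> tests the upper side first, so the value -1 also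
    requires that the edge is not eventually above.\<close>
  have not_both: "\<not> (\<forall>\<^sub>F t in at_right 0. a t > b t)" if "\<forall>\<^sub>F t in at_right 0. a t < b t" for a b :: "real \<Rightarrow> real"
  proof
    assume "\<forall>\<^sub>F t in at_right 0. a t > b t"
    with that have "\<forall>\<^sub>F t in at_right (0::real). False" by eventually_elim simp
    then show False by simp
  qed
  obtain S :: "('a, 'k) surface" where S: "surface_through \<A> v S" "\<forall>e\<in>E. type_indicator (\<gamma> e) S = sgn_type P e"
    using ex[of P] by blast
  obtain S' :: "('a, 'k) surface" where S': "surface_through \<A> v S'" "\<forall>e\<in>E. type_indicator (\<gamma> e) S' = sgn_type P' e"
    using ex[of P'] by blast
  show ?thesis
  proof (rule that[OF S(1) S'(1)])
    show "type_indicator (\<gamma> e0) S = - 1"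
      using S(2) e0 P not_both[OF P] by (simp add: sgn_type_def)
    show "type_indicator (\<gamma> e0) S' = 1"
      using S'(2) e0 P' by (simp add: sgn_type_def)
    fix e assume e: "e \<in> E" "e \<noteq> e0"
    have "sgn_type P e = sgn_type P' e"
      using PP'[OF e]
    proof (elim disjE conjE)
      \<comment> \<open>Here the common value may be 1, -1 or 0; in particular the edge may lie
        inside both surfaces.\<close>
      assume eq: "\<forall>\<^sub>F t in at_right 0. ?Q P (u \<bullet> c e t) = ?Q P' (u \<bullet> c e t)"
      have "(\<forall>\<^sub>F t in at_right 0. n \<bullet> c e t > ?Q P (u \<bullet> c e t)) \<longleftrightarrow> (\<forall>\<^sub>F t in at_right 0. n \<bullet> c e t > ?Q P' (u \<bullet> c e t))"
        by (rule eventually_subst, rule eventually_mono[OF eq]) (simp only:)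
      moreover have "(\<forall>\<^sub>F t in at_right 0. n \<bullet> c e t < ?Q P (u \<bullet> c e t)) \<longleftrightarrow> (\<forall>\<^sub>F t in at_right 0. n \<bullet> c e t < ?Q P' (u \<bullet> c e t))"
        by (rule eventually_subst, rule eventually_mono[OF eq]) (simp only:)
      ultimately show ?thesis by (simp add: sgn_type_def)
    next
      assume lt: "\<forall>\<^sub>F t in at_right 0. n \<bullet> c e t < ?Q P (u \<bullet> c e t)"
        "\<forall>\<^sub>F t in at_right 0. n \<bullet> c e t < ?Q P' (u \<bullet> c e t)"
      show ?thesis using lt not_both[OF lt(1)] not_both[OF lt(2)] by (simp add: sgn_type_def)
    qed (simp add: sgn_type_def)
    then show "type_indicator (\<gamma> e) S = type_indicator (\<gamma> e) S'" using S(2) S'(2) e(1) by simp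
  qed
qed

text \<open>Subtracting the two equations cancels every coefficient except the one at
  \<open>e0\<close>.\<close>

lemma isolate_term:
  fixes Y :: "'e \<Rightarrow> complex"
  assumes "finite E" "e0 \<in> E" "(\<Sum>e\<in>E. of_int (a e) * Y e) = 0" "(\<Sum>e\<in>E. of_int (a' e) * Y e) = 0"
    "\<And>e. e \<in> E \<Longrightarrow> e \<noteq> e0 \<Longrightarrow> a e = a' e" "a e0 \<noteq> a' e0"
  shows "Y e0 = 0"
proof -
  have "0 = (\<Sum>e\<in>E. of_int (a e) * Y e) - (\<Sum>e\<in>E. of_int (a' e) * Y e)" using assms by simp
  also have "\<dots> = (\<Sum>e\<in>E. of_int (a e - a' e) * Y e)"
    by (simp add: sum_subtractf algebra_simps)
  also have "\<dots> = of_int (a e0 - a' e0) * Y e0 + (\<Sum>e\<in>E - {e0}. of_int (a e - a' e) * Y e)"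
    by (rule sum.remove[OF assms(1,2)])
  also have "(\<Sum>e\<in>E - {e0}. of_int (a e - a' e) * Y e) = 0"
    by (rule sum.neutral) (use assms(5) in auto)
  finally show ?thesis using assms(6) by simp
qed

theorem mainTheorem2:
  fixes D :: nat
    and \<A> :: "('a::{t2_space,second_countable_topology}, 'd::finite) chart set"
    and \<gamma> :: "'e::finite \<Rightarrow> real \<Rightarrow> 'a"
    and v :: 'a
    and f :: "real ^ ('n::{finite,linorder}) ^ ('n::{finite,linorder}) ^ 'e \<Rightarrow> complex"
  assumes "D \<ge> 3"
    and "CARD('d) = D" and "CARD('k::finite) = D - 1" and "CARD('n::{finite,linorder}) = D + 1"
    and "analytic_atlas \<A>"
    and "analytic_graph \<A> \<gamma>"
    and "v \<in> vertices \<gamma>"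
    and "\<forall>e\<in>edges_at \<gamma> v. pathstart (\<gamma> e) = v"
    and "twice_differentiable_on_manifold f SO_family"
  shows "(\<forall>e\<in>edges_at \<gamma> v. \<forall>e'\<in>edges_at \<gamma> v. \<forall>I J K L. \<forall>h\<in>SO_family.
            antisym4 (\<lambda>i j k l. right_inv e i j (right_inv e' k l f) h) I J K L = 0)
     \<longleftrightarrow>
         (\<forall>(S :: ('a, 'k) surface) (S' :: ('a, 'k) surface).
            surface_through \<A> v S \<longrightarrow> surface_through \<A> v S' \<longrightarrow>
            (\<forall>M :: 'n::{finite,linorder} list. length M = D - 3 \<longrightarrow> (\<forall>h\<in>SO_family.
              (\<Sum>e\<in>edges_at \<gamma> v. \<Sum>e'\<in>edges_at \<gamma> v. \<Sum>I\<in>UNIV. \<Sum>J\<in>UNIV. \<Sum>K\<in>UNIV. \<Sum>L\<in>UNIV.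
                 of_int (type_indicator (\<gamma> e) S) * of_int (type_indicator (\<gamma> e') S') *
                 of_int (levi_civita ([I, J, K, L] @ M)) *
                 right_inv e I J (right_inv e' K L f) h) = 0)))"
proof -
  let ?E = "edges_at \<gamma> v"
  \<comment> \<open>The contraction for one pair of edges; the constraint is bilinear in the two
    families of indicators, with these values as coefficients.\<close>
  define X where "X M h e e' = (\<Sum>I\<in>UNIV. \<Sum>J\<in>UNIV. \<Sum>K\<in>UNIV. \<Sum>L\<in>UNIV.
    of_int (levi_civita ([I, J, K, L] @ M)) * right_inv e I J (right_inv e' K L f) h)" for M h e e'
  have factored: "(\<Sum>e\<in>?E. \<Sum>e'\<in>?E. \<Sum>I\<in>UNIV. \<Sum>J\<in>UNIV. \<Sum>K\<in>UNIV. \<Sum>L\<in>UNIV.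
      of_int (type_indicator (\<gamma> e) S) * of_int (type_indicator (\<gamma> e') S') *
      of_int (levi_civita ([I, J, K, L] @ M)) * right_inv e I J (right_inv e' K L f) h) =
    (\<Sum>e\<in>?E. of_int (type_indicator (\<gamma> e) S) * (\<Sum>e'\<in>?E. of_int (type_indicator (\<gamma> e') S') * X M h e e'))"
    for S S' :: "('a, 'k) surface" and M :: "'n::{finite,linorder} list" and h :: "real ^ ('n::{finite,linorder}) ^ ('n::{finite,linorder}) ^ 'e"
    unfolding X_def sum_distrib_left by (simp only: mult.assoc)
  have m: "D - 3 + 4 = CARD('n)" using assms(1,4) by simp
  have contr: "(\<forall>I J K L. antisym4 (\<lambda>i j k l. right_inv e i j (right_inv e' k l f) h) I J K L = 0) \<longleftrightarrow>
      (\<forall>M. length M = D - 3 \<longrightarrow> X M h e e' = 0)" for e e' h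
    unfolding X_def by (rule antisym4_eq_0_iff_contractions[OF m])
  show ?thesis
    unfolding factored
  proof (intro iffI allI impI ballI)
    fix S S' :: "('a, 'k) surface" and M :: "'n::{finite,linorder} list" and h :: "real ^ ('n::{finite,linorder}) ^ ('n::{finite,linorder}) ^ 'e"
    assume L: "\<forall>e\<in>?E. \<forall>e'\<in>?E. \<forall>I J K L. \<forall>h\<in>SO_family.
      antisym4 (\<lambda>i j k l. right_inv e i j (right_inv e' k l f) h) I J K L = 0"
      and M: "length M = D - 3" and h: "h \<in> SO_family"
    have "X M h e e' = 0" if "e \<in> ?E" "e' \<in> ?E" for e e'
      using contr[of e e' h] L that M h by blast
    then show "(\<Sum>e\<in>?E. of_int (type_indicator (\<gamma> e) S) * (\<Sum>e'\<in>?E. of_int (type_indicator (\<gamma> e') S') * X M h e e')) = 0"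
      by simp
  next
    fix e1 e2 and I J K L :: "'n::{finite,linorder}" and h :: "real ^ ('n::{finite,linorder}) ^ ('n::{finite,linorder}) ^ 'e"
    assume R: "\<forall>(S :: ('a, 'k) surface) (S' :: ('a, 'k) surface). surface_through \<A> v S \<longrightarrow> surface_through \<A> v S' \<longrightarrow>
        (\<forall>M. length M = D - 3 \<longrightarrow> (\<forall>h\<in>SO_family.
          (\<Sum>e\<in>?E. of_int (type_indicator (\<gamma> e) S) * (\<Sum>e'\<in>?E. of_int (type_indicator (\<gamma> e') S') * X M h e e')) = 0))"
      and e1: "e1 \<in> ?E" and e2: "e2 \<in> ?E" and h: "h \<in> SO_family"
    have card: "CARD('k) + 1 = CARD('d)" "CARD('d) \<ge> 2" using assms(1-3) by auto
    have start: "\<And>e. e \<in> ?E \<Longrightarrow> pathstart (\<gamma> e) = v" using assms(8) by blast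
    obtain S1 S1' :: "('a, 'k) surface" where S1: "surface_through \<A> v S1" "surface_through \<A> v S1'"
      "type_indicator (\<gamma> e1) S1 = - 1" "type_indicator (\<gamma> e1) S1' = 1"
      "\<And>e. e \<in> ?E \<Longrightarrow> e \<noteq> e1 \<Longrightarrow> type_indicator (\<gamma> e) S1 = type_indicator (\<gamma> e) S1'"
      by (rule isolating_surfaces[OF assms(5,6) start e1 card]) (assumption, rule that)
    obtain S2 S2' :: "('a, 'k) surface" where S2: "surface_through \<A> v S2" "surface_through \<A> v S2'"
      "type_indicator (\<gamma> e2) S2 = - 1" "type_indicator (\<gamma> e2) S2' = 1"
      "\<And>e. e \<in> ?E \<Longrightarrow> e \<noteq> e2 \<Longrightarrow> type_indicator (\<gamma> e) S2 = type_indicator (\<gamma> e) S2'"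
      by (rule isolating_surfaces[OF assms(5,6) start e2 card]) (assumption, rule that)
    have "X M h e1 e2 = 0" if M: "length M = D - 3" for M
    proof -
      \<comment> \<open>With \<open>S'\<close> and \<open>h\<close> fixed, the pair
        \<open>S1\<close>, \<open>S1'\<close> isolates \<open>e1\<close> in the outer sum;
        afterwards \<open>S2\<close>, \<open>S2'\<close> isolate \<open>e2\<close> in the inner one.
        The two surfaces of a constraint vary independently, so this includes
        \<open>e1 = e2\<close>.\<close>
      have *: "(\<Sum>e'\<in>?E. of_int (type_indicator (\<gamma> e') S') * X M h e1 e') = 0"
        if "surface_through \<A> v S'" for S' :: "('a, 'k) surface"
        by (rule isolate_term[OF finite e1, where a = "\<lambda>e. type_indicator (\<gamma> e) S1" and a' = "\<lambda>e. type_indicator (\<gamma> e) S1'"])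
           (use R S1 that M h in auto)
      show ?thesis
        by (rule isolate_term[OF finite e2, where a = "\<lambda>e. type_indicator (\<gamma> e) S2" and a' = "\<lambda>e. type_indicator (\<gamma> e) S2'"])
           (use * S2 in auto)
    qed
    then show "antisym4 (\<lambda>i j k l. right_inv e1 i j (right_inv e2 k l f) h) I J K L = 0"
      using contr[of e1 e2 h] by blast
  qed
qed

end
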